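(* Let $p$ be a prime, let $L := \mathbb{Z}/p \wr \mathbb{Z}$ be the $p$-lamplighter group, and let $X$ be any finite generating set of $L$. Let $\mathrm{RF}_L = \mathrm{RF}_{L,X}$ denote the residual finiteness growth of $L$ with respect to $X$. Then $$n^{3/2} \preceq \mathrm{RF}_L(n) \preceq n^2 .$$
   Context: Lamplighter group: for a prime $p$, $L = \mathbb{Z}/p \wr \mathbb{Z}$ is the semidirect product $\left(\bigoplus_{i\in\mathbb{Z}} \mathbb{Z}/p\right)\rtimes \mathbb{Z}$, where $\mathbb{Z}$ acts on finitely supported sequences by shifting indices: $b\cdot (a_i)_{i\in\mathbb{Z}} = (a_{b+i})_{i\in\mathbb{Z}}$ for $b\in\mathbb{Z}$. It is a finitely generated residually finite group. Residual finiteness growth: let $\Gamma$ be a residually finite group with finite generating set $X$. For $\gamma\in\Gamma\setminus\{1\}$ define $D_\Gamma(\gamma) = \min\{[\Gamma:\Delta] : \Delta\lhd\Gamma,\ [\Gamma:\Delta]<\infty,\ \gamma\notin\Delta\}$. Let $B_{\Gamma,X}(n)$ be the set of elements of $\Gamma$ of word length at most $n$ with respect to $X$ ($n$ a nonnegative real number; words use elements of $X$ and their inverses). Then $\mathrm{RF}_{\Gamma,X}(n)$ is the maximum of $D_\Gamma$ on $B_{\Gamma,X}(n)\setminus\{1\}$ (with value $0$ if this set is empty). Asymptotic notation: $f\preceq g$ means that there exists a constant $C>0$ such that $f(n)\le C\,g(Cn)$ for all positive integers $n$. Up to the equivalence ($f\preceq g$ and $g\preceq f$), the growth of $\mathrm{RF}_{\Gamma,X}$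 does not depend on the choice of the finite generating set $X$, so the subscript $X$ is dropped. The constants may depend on $p$ and $X$. *)

theory Defs
  imports
    Complex_Main
    "HOL-Computational_Algebra.Primes"
    "HOL-Algebra.Coset"
    "HOL-Algebra.Generated_Groups"
    "HOL-Algebra.Product_Groups"
    "HOL-Algebra.Elementary_Groups"
begin

section \<open>The lamplighter group\<close>

definition semidirect_product ::
  "('a, 'c) monoid_scheme \<Rightarrow> ('b, 'd) monoid_scheme \<Rightarrow> ('b \<Rightarrow> 'a \<Rightarrow> 'a) \<Rightarrow> ('a \<times> 'b) monoid"
  where "semidirect_product N H \<phi> =
    \<lparr>carrier = carrier N \<times> carrier H,
     monoid.mult = (\<lambda>(a, b) (a', b'). (a \<otimes>\<^bsub>N\<^esub> \<phi> b a', b \<otimes>\<^bsub>H\<^esub> b')),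
     one = (\<one>\<^bsub>N\<^esub>, \<one>\<^bsub>H\<^esub>)\<rparr>"

definition shift :: "int \<Rightarrow> (int \<Rightarrow> 'a) \<Rightarrow> (int \<Rightarrow> 'a)"
  where "shift b a = (\<lambda>i. a (b + i))"

definition lamplighter :: "nat \<Rightarrow> ((int \<Rightarrow> int) \<times> int) monoid"
  where "lamplighter p =
    semidirect_product (sum_group UNIV (\<lambda>_. integer_mod_group p)) integer_group shift"

lemma group_lamplighter: "group (lamplighter p)"
proof -
  let ?Z = "integer_mod_group p"
  let ?N = "sum_group (UNIV :: int set) (\<lambda>_. ?Z)"
  have N: "group ?N" by simp
  interpret N: group ?N by (rule N)
  have sh: "shift b a \<in> carrier ?N" if a: "a \<in> carrier ?N" for a b
  proof -
    have "{i. a (b + i) \<noteq> 0} = (\<lambda>i. i - b) ` {i. a i \<noteq> 0}"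
      by (force simp: image_iff)
    then show ?thesis using a
      by (simp add: carrier_sum_group shift_def PiE_iff extensional_def)
  qed
  have shm: "shift b (a \<otimes>\<^bsub>?N\<^esub> a') = shift b a \<otimes>\<^bsub>?N\<^esub> shift b a'" for a a' b
    by (auto simp: shift_def)
  have shs: "shift b (shift c a) = shift (b + c) a" for a :: "int \<Rightarrow> int" and b c
    by (auto simp: shift_def add_ac)
  have sh0: "shift 0 a = a" for a :: "int \<Rightarrow> int"
    by (auto simp: shift_def)
  have sh1: "shift b \<one>\<^bsub>?N\<^esub> = \<one>\<^bsub>?N\<^esub>" for b
    by (auto simp: shift_def)
  show ?thesis
  proof (rule groupI, goal_cases)
    case (1 x y)
    then show ?case
      using N.m_closed sh by (auto simp: lamplighter_def semidirect_product_def simp del: mult_sum_group)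
  next
    case 2
    then show ?case
      using N.one_closed by (auto simp: lamplighter_def semidirect_product_def simp del: one_sum_group)
  next
    case (3 x y z)
    then show ?case
      using N.m_assoc sh
      by (auto simp: lamplighter_def semidirect_product_def shm shs add_ac simp del: mult_sum_group)
  next
    case (4 x)
    then show ?case
      using N.l_one
      by (auto simp: lamplighter_def semidirect_product_def sh0 simp del: mult_sum_group one_sum_group)
  next
    case (5 x)
    obtain a b where x: "x = (a, b)" by (cases x)
    have a: "a \<in> carrier ?N" using 5 x by (auto simp: lamplighter_def semidirect_product_def)
    let ?y = "(shift (- b) (inv\<^bsub>?N\<^esub> a), - b)"
    have "shift (- b) (inv\<^bsub>?N\<^esub> a) \<otimes>\<^bsub>?N\<^esub> shift (- b) a = \<one>\<^bsub>?N\<^esub>"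
      using shm[of "- b" "inv\<^bsub>?N\<^esub> a" a] N.l_inv[OF a] sh1 by metis
    then have "?y \<otimes>\<^bsub>lamplighter p\<^esub> x = \<one>\<^bsub>lamplighter p\<^esub>"
      by (simp add: x lamplighter_def semidirect_product_def del: mult_sum_group one_sum_group)
    moreover have "?y \<in> carrier (lamplighter p)"
      using sh[OF N.inv_closed[OF a]] by (simp add: lamplighter_def semidirect_product_def)
    ultimately show ?case by blast
  qed
qed


section \<open>Residual finiteness growth\<close>

definition word_length :: "('a, 'b) monoid_scheme \<Rightarrow> 'a set \<Rightarrow> 'a \<Rightarrow> nat"
  where "word_length G X g =
    (LEAST k. \<exists>w. set w \<subseteq> X \<union> m_inv G ` X \<and> length w = k \<and> foldr (monoid.mult G) w \<one>\<^bsub>G\<^esub> = g)"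

text \<open>\<^const>\<open>word_length\<close> is only meaningful on \<^term>\<open>generate G X\<close>, hence the membership
  condition.\<close>

definition word_ball :: "('a, 'b) monoid_scheme \<Rightarrow> 'a set \<Rightarrow> real \<Rightarrow> 'a set"
  where "word_ball G X n = {g \<in> generate G X. real (word_length G X g) \<le> n}"

text \<open>The infimum in \<^typ>\<open>nat\<close> is a minimum when the set is nonempty, that is, whenever \<open>\<gamma>\<close> is
  separated from \<open>\<one>\<close> by a finite quotient; for a residually finite group this holds for
  every \<open>\<gamma> \<noteq> \<one>\<close>.\<close>

definition residual_depth :: "('a, 'b) monoid_scheme \<Rightarrow> 'a \<Rightarrow> nat"
  where "residual_depth G \<gamma> =
    Inf {card (rcosets\<^bsub>G\<^esub> \<Delta>) | \<Delta>. \<Delta> \<lhd> G \<and> finite (rcosets\<^bsub>G\<^esub> \<Delta>) \<and> \<gamma> \<notin> \<Delta>}"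

definition RF :: "('a, 'b) monoid_scheme \<Rightarrow> 'a set \<Rightarrow> real \<Rightarrow> nat"
  where "RF G X n =
    (let B = word_ball G X n - {\<one>\<^bsub>G\<^esub>} in
     if B = {} then 0 else Max (residual_depth G ` B))"

text \<open>For finite \<open>X\<close> the maximum in \<^const>\<open>RF\<close> ranges over a finite set.\<close>

lemma (in group) generate_word:
  assumes "X \<subseteq> carrier G" "g \<in> generate G X"
  shows "\<exists>w. set w \<subseteq> X \<union> m_inv G ` X \<and> foldr (\<otimes>) w \<one> = g"
  using assms(2)
proof (induction rule: generate.induct)
  case one
  show ?case by (rule exI[of _ "[]"]) simp
next
  case (incl h)
  then show ?case using assms(1) by (intro exI[of _ "[h]"]) auto
next
  case (inv h)
  then show ?case using assms(1) by (intro exI[of _ "[m_inv G h]"]) auto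
next
  case (eng g h)
  then obtain v w where
    v: "set v \<subseteq> X \<union> m_inv G ` X" "foldr (\<otimes>) v \<one> = g" and
    w: "set w \<subseteq> X \<union> m_inv G ` X" "foldr (\<otimes>) w \<one> = h"
    by blast
  have S: "X \<union> m_inv G ` X \<subseteq> carrier G" using assms(1) by auto
  have c: "foldr (\<otimes>) u \<one> \<in> carrier G" if "set u \<subseteq> X \<union> m_inv G ` X" for u
    using that S by (induction u) auto
  have "foldr (\<otimes>) (u @ w) \<one> = foldr (\<otimes>) u \<one> \<otimes> h" if "set u \<subseteq> X \<union> m_inv G ` X" for u
    using that
  proof (induction u)
    case Nil
    then show ?case using w c by auto
  next
    case (Cons x u)
    then have "x \<in> carrier G" "foldr (\<otimes>) u \<one> \<in> carrier G" "h \<in> carrier G"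
      using S c w by auto
    with Cons show ?case by (simp add: m_assoc)
  qed
  with v w show ?case by (intro exI[of _ "v @ w"]) auto
qed

lemma (in group) finite_word_ball:
  assumes "X \<subseteq> carrier G" "finite X"
  shows "finite (word_ball G X n)"
proof -
  let ?S = "X \<union> m_inv G ` X"
  have "word_ball G X n \<subseteq>
      (\<lambda>w. foldr (\<otimes>) w \<one>) ` {w. set w \<subseteq> ?S \<and> length w \<le> nat \<lfloor>n\<rfloor>}"
  proof
    fix g assume g: "g \<in> word_ball G X n"
    then have "\<exists>k w. set w \<subseteq> ?S \<and> length w = k \<and> foldr (\<otimes>) w \<one> = g"
      using generate_word[OF assms(1), of g] by (simp add: word_ball_def)
    then have "\<exists>w. set w \<subseteq> ?S \<and> length w = word_length G X g \<and> foldr (\<otimes>) w \<one> = g"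
      unfolding word_length_def by (rule LeastI_ex)
    moreover have "word_length G X g \<le> nat \<lfloor>n\<rfloor>"
      using g by (simp add: word_ball_def le_nat_floor)
    ultimately show "g \<in> (\<lambda>w. foldr (\<otimes>) w \<one>) ` {w. set w \<subseteq> ?S \<and> length w \<le> nat \<lfloor>n\<rfloor>}"
      by auto
  qed
  moreover have "finite ?S"
    using assms by simp
  ultimately show ?thesis
    by (rule finite_subset[OF _ finite_imageI[OF finite_lists_length_le]])
qed


section \<open>Comparison of growth functions\<close>

definition growth_le :: "(real \<Rightarrow> real) \<Rightarrow> (real \<Rightarrow> real) \<Rightarrow> bool"  (infix "\<preceq>" 50)
  where "f \<preceq> g \<longleftrightarrow> (\<exists>C>0. \<forall>n::nat. n > 0 \<longrightarrow> f (real n) \<le> C * g (C * real n))"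

end

theory Submission
  imports Defs "HOL-Computational_Algebra.Polynomial"
begin

text \<open>
  A finite-index normal subgroup \<open>N\<close> of the lamplighter group meets the base group in an ideal \<open>I\<close>
  of the Laurent polynomials over the field with \<open>p\<close> elements. If \<open>m\<int>\<close> is the image of
  \<open>N\<close> in \<open>\<int>\<close>, then \<open>X ^ m - 1 \<in> I\<close> and the index of \<open>N\<close> is \<open>m\<close> times the index of \<open>I\<close>.

  Upper bound: a nonzero polynomial of degree \<open>O(n)\<close> is nonzero at some unit of a field with
  \<open>q = O(n)\<close> elements, and there \<open>X\<close> has order at most \<open>q - 1\<close>, so the index is at most \<open>q ^ 2\<close>.

  Lower bound: take \<open>f\<close> to be the product of all \<open>X ^ r - 1\<close> with \<open>r \<le> sqrt n\<close> and of all
  \<open>(X ^ (p ^ i) - X) ^ (d + 1 - i)\<close> with \<open>1 \<le> i \<le> d\<close>, where \<open>p ^ d \<le> n < p ^ (d + 1)\<close>. The degree of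
  \<open>f\<close> is \<open>O(n)\<close>. If \<open>f \<notin> I\<close>, the first factors force \<open>m > sqrt n\<close>, and the second ones force
  the index of \<open>I\<close> to be at least \<open>p ^ (d + 1) > n\<close>.

  Ideals over the field with \<open>p\<close> elements are represented by ideals of integer polynomials
  containing \<open>p\<close>.
\<close>

section \<open>Ideals of commutative rings\<close>

definition is_ideal :: "'a::comm_ring_1 set \<Rightarrow> bool"
  where "is_ideal I \<longleftrightarrow> 0 \<in> I \<and> (\<forall>x\<in>I. \<forall>y\<in>I. x + y \<in> I) \<and> (\<forall>r. \<forall>x\<in>I. r * x \<in> I)"

definition is_prime_ideal :: "'a::comm_ring_1 set \<Rightarrow> bool"
  where "is_prime_ideal I \<longleftrightarrow> is_ideal I \<and> 1 \<notin> I \<and> (\<forall>x y. x * y \<in> I \<longrightarrow> x \<in> I \<or> y \<in> I)"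

text \<open>The index of \<open>I\<close> is below a bound B exactly when every finite set of
  pairwise incongruent elements has fewer than B members. Indices are measured this way so that no
  quotient ring has to be formed.\<close>

definition incongruent :: "'a::comm_ring_1 set \<Rightarrow> 'a set \<Rightarrow> bool"
  where "incongruent I S \<longleftrightarrow> (\<forall>x\<in>S. \<forall>y\<in>S. x - y \<in> I \<longrightarrow> x = y)"

lemma is_ideal_zero: "is_ideal I \<Longrightarrow> 0 \<in> I"
  and is_ideal_add: "is_ideal I \<Longrightarrow> x \<in> I \<Longrightarrow> y \<in> I \<Longrightarrow> x + y \<in> I"
  and is_ideal_mult: "is_ideal I \<Longrightarrow> x \<in> I \<Longrightarrow> r * x \<in> I"
  by (auto simp: is_ideal_def)

lemma is_ideal_mult': "is_ideal I \<Longrightarrow> x \<in> I \<Longrightarrow> x * r \<in> I"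
  using is_ideal_mult[of I x r] by (simp add: mult.commute)

lemma is_ideal_dvd: "is_ideal I \<Longrightarrow> x \<in> I \<Longrightarrow> x dvd y \<Longrightarrow> y \<in> I"
  by (auto simp: dvd_def is_ideal_mult')

lemma is_ideal_uminus: "is_ideal I \<Longrightarrow> x \<in> I \<Longrightarrow> - x \<in> I"
  by (rule is_ideal_dvd) auto

lemma is_ideal_diff: "is_ideal I \<Longrightarrow> x \<in> I \<Longrightarrow> y \<in> I \<Longrightarrow> x - y \<in> I"
  using is_ideal_add[of I x "- y"] is_ideal_uminus by auto

lemma is_ideal_sum: "is_ideal I \<Longrightarrow> (\<And>i. i \<in> A \<Longrightarrow> f i \<in> I) \<Longrightarrow> sum f A \<in> I"
  by (induction A rule: infinite_finite_induct) (auto simp: is_ideal_zero is_ideal_add)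

lemma ideal_cong_add:
  assumes "is_ideal I" "x - x' \<in> I" "y - y' \<in> I"
  shows "(x + y) - (x' + y') \<in> I"
  using is_ideal_add[OF assms] by (simp add: algebra_simps)

lemma ideal_cong_mult:
  assumes "is_ideal I" "x - x' \<in> I" "y - y' \<in> I"
  shows "x * y - x' * y' \<in> I"
proof -
  have "x * y - x' * y' = (x - x') * y + x' * (y - y')" by (simp add: algebra_simps)
  then show ?thesis using assms by (simp add: is_ideal_add is_ideal_mult is_ideal_mult')
qed

lemma ideal_cong_power: "is_ideal I \<Longrightarrow> x - y \<in> I \<Longrightarrow> x ^ n - y ^ n \<in> I"
  by (induction n) (auto simp: is_ideal_zero intro: ideal_cong_mult)

lemma ideal_cong_trans: "is_ideal I \<Longrightarrow> x - y \<in> I \<Longrightarrow> y - z \<in> I \<Longrightarrow> x - z \<in> I"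
  using is_ideal_add[of I "x - y" "y - z"] by simp

lemma ideal_cong_sym: "is_ideal I \<Longrightarrow> x - y \<in> I \<Longrightarrow> y - x \<in> I"
  using is_ideal_uminus[of I "x - y"] by simp

text \<open>Zorn's lemma on the ideals above \<open>I\<close> that avoid \<open>a\<close>. The last
  property is maximality in usable form: for \<open>x\<close> outside \<open>J\<close>, the ideal J
  + (x) must contain \<open>a\<close>.\<close>

lemma ideal_maximal_avoiding:
  assumes I: "is_ideal I" and a: "a \<notin> I"
  obtains J where "is_ideal J" "I \<subseteq> J" "a \<notin> J" "\<And>x. x \<notin> J \<Longrightarrow> \<exists>r. a - r * x \<in> J"
proof -
  let ?A = "{J. is_ideal J \<and> I \<subseteq> J \<and> a \<notin> J}"
  have "\<exists>M\<in>?A. \<forall>X\<in>?A. M \<subseteq> X \<longrightarrow> X = M"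
  proof (rule subset_Zorn_nonempty)
    show "?A \<noteq> {}" using assms by blast
    fix \<C> assume ne: "\<C> \<noteq> {}" and ch: "subset.chain ?A \<C>"
    have id: "is_ideal J" "I \<subseteq> J" "a \<notin> J" if "J \<in> \<C>" for J
      using ch that unfolding subset.chain_def by auto
    have "is_ideal (\<Union>\<C>)"
      unfolding is_ideal_def
    proof (intro conjI ballI allI)
      show "0 \<in> \<Union>\<C>" using ne id is_ideal_zero by fastforce
    next
      fix x y assume "x \<in> \<Union>\<C>" "y \<in> \<Union>\<C>"
      then obtain J K where JK: "J \<in> \<C>" "K \<in> \<C>" "x \<in> J" "y \<in> K" by blast
      then have "J \<subseteq> K \<or> K \<subseteq> J" using ch unfolding subset.chain_def by blast
      then show "x + y \<in> \<Union>\<C>"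
        using JK id by (meson UnionI is_ideal_add subsetD)
    next
      fix r x assume "x \<in> \<Union>\<C>"
      then show "r * x \<in> \<Union>\<C>" using id is_ideal_mult by blast
    qed
    then show "\<Union>\<C> \<in> ?A" using ne id by blast
  qed
  then obtain M where MA: "M \<in> ?A" and mx: "\<forall>X\<in>?A. M \<subseteq> X \<longrightarrow> X = M"
    by (elim bexE)
  from MA have M: "is_ideal M" "I \<subseteq> M" "a \<notin> M" by simp_all
  have max: "X = M" if "is_ideal X" "a \<notin> X" "M \<subseteq> X" for X
    using mx that M(2) by simp
  have "\<exists>r. a - r * x \<in> M" if x: "x \<notin> M" for x
  proof (rule ccontr)
    assume no: "\<nexists>r. a - r * x \<in> M"
    \<comment> \<open>This is the ideal M + (x), strictly larger than \<open>M\<close>; it avoids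
      \<open>a\<close> by the assumption.\<close>
    define N where "N = {y. \<exists>r. y - r * x \<in> M}"
    have "is_ideal N"
      unfolding is_ideal_def
    proof (intro conjI ballI allI)
      show "0 \<in> N" unfolding N_def using is_ideal_zero[OF M(1)] by (auto intro: exI[of _ 0])
    next
      fix y z assume "y \<in> N" "z \<in> N"
      then obtain r s where "y - r * x \<in> M" "z - s * x \<in> M" by (auto simp: N_def)
      then have "(y + z) - (r + s) * x \<in> M" using ideal_cong_add[OF M(1)] by (simp add: distrib_right)
      then show "y + z \<in> N" by (auto simp: N_def)
    next
      fix s y assume "y \<in> N"
      then obtain r where "y - r * x \<in> M" by (auto simp: N_def)
      then have "s * y - (s * r) * x \<in> M"
        using is_ideal_mult[OF M(1), of "y - r * x" s] by (simp add: algebra_simps)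
      then show "s * y \<in> N" by (auto simp: N_def)
    qed
    moreover have "M \<subseteq> N" unfolding N_def by (auto intro: exI[of _ 0])
    moreover have "a \<notin> N" using no by (simp add: N_def)
    ultimately have "N = M" using max by blast
    moreover have "x \<in> N" unfolding N_def using is_ideal_zero[OF M(1)] by (auto intro: exI[of _ 1])
    ultimately show False using x by simp
  qed
  then show thesis using that M by blast
qed

text \<open>Maximality among the ideals avoiding 1 makes every element outside \<open>M\<close>
  invertible modulo \<open>M\<close>, and a product of units is a unit.\<close>

lemma prime_ideal_above:
  assumes "is_ideal I" "1 \<notin> I"
  obtains M where "is_prime_ideal M" "I \<subseteq> M"
proof -
  obtain M where M: "is_ideal M" "I \<subseteq> M" "1 \<notin> M" "\<And>x. x \<notin> M \<Longrightarrow> \<exists>r. 1 - r * x \<in> M"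
    using ideal_maximal_avoiding[OF assms] by blast
  have "x \<in> M \<or> y \<in> M" if xy: "x * y \<in> M" for x y
  proof (rule ccontr)
    assume "\<not> ?thesis"
    then obtain r s where "1 - r * x \<in> M" "1 - s * y \<in> M" using M(4) by blast
    then have "1 * 1 - (r * x) * (s * y) \<in> M" using ideal_cong_mult M(1) by blast
    moreover have "(r * s) * (x * y) \<in> M" using xy is_ideal_mult M(1) by blast
    ultimately have "(1 * 1 - (r * x) * (s * y)) + (r * s) * (x * y) \<in> M"
      using is_ideal_add M(1) by blast
    then show False using M(3) by (simp add: algebra_simps)
  qed
  then show thesis using that M unfolding is_prime_ideal_def by blast
qed

lemma prime_ideal_power: "is_prime_ideal M \<Longrightarrow> x ^ n \<in> M \<Longrightarrow> x \<in> M"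
  by (induction n) (auto simp: is_prime_ideal_def)

text \<open>Modulo a prime ideal the ring is a domain, where a nonzero polynomial has at most as
  many roots as its degree. The induction splits off a linear factor by synthetic division; the
  other roots are roots of the quotient because differences of incongruent elements lie outside
  \<open>M\<close>.\<close>

lemma coeff_in_prime_ideal_of_roots:
  fixes F :: "'a::comm_ring_1 poly"
  assumes M: "is_prime_ideal M"
    and "finite Y" "incongruent M Y" "card Y > degree F" "\<And>y. y \<in> Y \<Longrightarrow> poly F y \<in> M"
  shows "coeff F i \<in> M"
  using assms(2-5)
proof (induction "degree F" arbitrary: F Y i)
  case 0
  then obtain y where "y \<in> Y" by fastforce
  moreover obtain c where "F = [:c:]" using 0(1) by (metis degree_eq_zeroE)
  moreover have "poly F y \<in> M" using 0 \<open>y \<in> Y\<close> by blast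
  moreover have "0 \<in> M" using M by (simp add: is_prime_ideal_def is_ideal_zero)
  ultimately show ?case by (cases i) auto
next
  case (Suc n)
  have I: "is_ideal M" using M by (simp add: is_prime_ideal_def)
  obtain y where y: "y \<in> Y" using Suc.prems by fastforce
  define G where "G = synthetic_div F y"
  have F: "F = [:- y, 1:] * G + [:poly F y:]"
    using synthetic_div_correct'[of y F] by (simp add: G_def)
  have dG: "n = degree G" using Suc.hyps(2) by (simp add: G_def degree_synthetic_div)
  have G: "coeff G i \<in> M" for i
  proof (rule Suc.hyps(1)[OF dG, of "Y - {y}"])
    fix z assume z: "z \<in> Y - {y}"
    have "poly F z - poly F y \<in> M" using Suc.prems y z I by (intro is_ideal_diff) auto
    moreover have "poly F z - poly F y = (z - y) * poly G z"
      using arg_cong[OF F, of "\<lambda>F. poly F z"] by (simp add: algebra_simps)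
    ultimately have "(z - y) * poly G z \<in> M" by simp
    moreover have "z - y \<notin> M" using Suc.prems(2) y z by (auto simp: incongruent_def)
    ultimately show "poly G z \<in> M" using M by (auto simp: is_prime_ideal_def)
  qed (use Suc.prems Suc.hyps y dG in \<open>auto simp: incongruent_def\<close>)
  have "coeff F i = coeff (pCons (poly F y) G) i - y * coeff G i"
    using arg_cong[OF F, of "\<lambda>F. coeff F i"] by (cases i) (simp_all add: algebra_simps)
  moreover have "coeff (pCons (poly F y) G) i \<in> M"
    using G y Suc.prems by (cases i) auto
  ultimately show ?case using G I by (simp add: is_ideal_diff is_ideal_mult)
qed

section \<open>The Frobenius map modulo an ideal that contains a prime number\<close>

lemma freshmans_dream_ideal:
  fixes x y :: "'a::comm_ring_1"
  assumes I: "is_ideal I" and p: "prime p" "of_nat p \<in> I"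
  shows "(x + y) ^ (p ^ k) - (x ^ (p ^ k) + y ^ (p ^ k)) \<in> I"
proof (induction k)
  case 0
  then show ?case using I by (simp add: is_ideal_zero)
next
  case (Suc k)
  have one: "(u + v) ^ p - (u ^ p + v ^ p) \<in> I" for u v :: 'a
  proof -
    have p0: "p > 0" using p prime_gt_0_nat by blast
    have "(u + v) ^ p = (\<Sum>k\<le>p. of_nat (p choose k) * u ^ k * v ^ (p - k))"
      by (rule binomial_ring)
    also have "{..p} = insert 0 (insert p {0<..<p})" using p0 by auto
    also have "(\<Sum>k\<in>\<dots>. of_nat (p choose k) * u ^ k * v ^ (p - k))
      = v ^ p + (u ^ p + (\<Sum>k\<in>{0<..<p}. of_nat (p choose k) * u ^ k * v ^ (p - k)))"
      using p0 by simp
    finally have "(u + v) ^ p - (u ^ p + v ^ p)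
      = (\<Sum>k\<in>{0<..<p}. of_nat (p choose k) * u ^ k * v ^ (p - k))" by simp
    also have "\<dots> \<in> I"
    proof (rule is_ideal_sum[OF I])
      fix k assume "k \<in> {0<..<p}"
      then have "p dvd p choose k" using p by (intro dvd_choose_prime) auto
      then obtain j where "p choose k = p * j" by (elim dvdE)
      then show "of_nat (p choose k) * u ^ k * v ^ (p - k) \<in> I"
        using is_ideal_dvd[OF I p(2)] by (simp add: mult.assoc)
    qed
    finally show ?thesis .
  qed
  have "(x + y) ^ p ^ Suc k - ((x ^ p ^ k + y ^ p ^ k) ^ p) \<in> I"
    using ideal_cong_power[OF I Suc.IH, of p] by (simp only: power_Suc2 power_mult)
  moreover have "(x ^ p ^ k + y ^ p ^ k) ^ p - (x ^ p ^ Suc k + y ^ p ^ Suc k) \<in> I"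
    using one[of "x ^ p ^ k" "y ^ p ^ k"] by (simp only: power_Suc2 power_mult)
  ultimately show ?case by (rule ideal_cong_trans[OF I])
qed

text \<open>Fermat's little theorem modulo \<open>I\<close>: additivity of the Frobenius map carries
  the congruence from \<open>c\<close> to its two neighbours.\<close>

lemma of_int_frobenius_ideal:
  assumes I: "is_ideal I" and p: "prime p" "of_nat p \<in> I"
  shows "(of_int c :: 'a::comm_ring_1) ^ (p ^ k) - of_int c \<in> I"
proof (induction c rule: int_induct[of _ 0])
  case base
  have "p ^ k > 0" using p by (simp add: prime_gt_0_nat)
  then have "(0 :: 'a) ^ (p ^ k) = 0" by (rule zero_power)
  then show ?case using I by (simp add: is_ideal_zero)
next
  case (step1 c)
  have "(of_int c + 1) ^ p ^ k - (of_int c ^ p ^ k + 1 :: 'a) \<in> I"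
    using freshmans_dream_ideal[OF I p, of "of_int c" 1 k] by simp
  from is_ideal_add[OF I this step1(2)] show ?case by (simp add: algebra_simps)
next
  case (step2 c)
  have "of_int c ^ p ^ k - (of_int (c - 1) ^ p ^ k + 1 :: 'a) \<in> I"
    using freshmans_dream_ideal[OF I p, of "of_int (c - 1)" 1 k] by simp
  from is_ideal_diff[OF I step2(2) this] show ?case by (simp add: algebra_simps)
qed

section \<open>Ideals of integer polynomials containing a prime\<close>

definition poly_X :: "int poly" where "poly_X = [:0, 1:]"

text \<open>Frobenius is a ring endomorphism modulo \<open>I\<close> that fixes the integer
  coefficients of \<open>f\<close>. Hence it sends f(y) to f(y^Q), and powers of a root are again
  roots.\<close>

lemma pcompose_frobenius_ideal:
  fixes f y :: "int poly"
  assumes I: "is_ideal I" and p: "prime p" "of_nat p \<in> I"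
  shows "pcompose f (y ^ (p ^ k)) - pcompose f y ^ (p ^ k) \<in> I"
proof (induction f)
  case 0
  have "p ^ k > 0" using p by (simp add: prime_gt_0_nat)
  then have z: "(0 :: int poly) ^ (p ^ k) = 0" by (rule zero_power)
  show ?case unfolding pcompose_0 z using is_ideal_zero[OF I] by simp
next
  case (pCons a f)
  let ?Q = "p ^ k"
  have "[:a:] ^ ?Q - [:a:] \<in> I"
    using of_int_frobenius_ideal[OF I p, of a k] by (simp add: of_int_poly)
  from ideal_cong_add[OF I ideal_cong_sym[OF I this] ideal_cong_mult[OF I _ pCons.IH]]
  have "([:a:] + y ^ ?Q * pcompose f (y ^ ?Q)) - ([:a:] ^ ?Q + y ^ ?Q * pcompose f y ^ ?Q) \<in> I"
    using is_ideal_zero[OF I] by simp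
  moreover have "([:a:] ^ ?Q + y ^ ?Q * pcompose f y ^ ?Q) - ([:a:] + y * pcompose f y) ^ ?Q \<in> I"
    using ideal_cong_sym[OF I freshmans_dream_ideal[OF I p, of "[:a:]" "y * pcompose f y" k]]
    by (simp add: power_mult_distrib)
  ultimately show ?case
    unfolding pcompose_pCons by (rule ideal_cong_trans[OF I])
qed

lemma dvd_of_int_mem_ideal:
  assumes I: "is_ideal I" "1 \<notin> I" and p: "prime p" "of_nat p \<in> I"
    and c: "(of_int c :: 'a::comm_ring_1) \<in> I"
  shows "int p dvd c"
proof (rule ccontr)
  assume "\<not> int p dvd c"
  then have "coprime (int p) c" using p(1) by (intro prime_imp_coprime) auto
  then obtain u v where uv: "u * int p + v * c = 1"
    by (metis bezout_int coprime_imp_gcd_eq_1)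
  have "of_int u * of_nat p + of_int v * of_int c \<in> I"
    using I(1) p(2) c by (intro is_ideal_add is_ideal_mult)
  also have "of_int u * of_nat p + of_int v * of_int c = (of_int (u * int p + v * c) :: 'a)" by simp
  finally show False using uv I(2) by simp
qed

lemma poly_map_poly_const: "poly (map_poly (\<lambda>c. [:c:]) f) y = pcompose f y"
  by (induction f) (auto simp: map_poly_pCons pcompose_pCons)

text \<open>Roots are sought in the polynomial ring itself, so the coefficients of \<open>f\<close>
  are first turned into constants there. The root bound puts them into \<open>M\<close>, and a
  proper ideal containing \<open>p\<close> contains only those integers that \<open>p\<close>
  divides.\<close>

lemma dvd_coeff_of_roots:
  fixes f :: "int poly"
  assumes M: "is_prime_ideal M" and p: "prime p" "of_nat p \<in> M"
    and "finite Y" "incongruent M Y" "card Y > degree f" "\<And>y. y \<in> Y \<Longrightarrow> pcompose f y \<in> M"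
  shows "int p dvd coeff f i"
proof (rule dvd_of_int_mem_ideal[OF _ _ p])
  show "is_ideal M" "1 \<notin> M" using M by (auto simp: is_prime_ideal_def)
  let ?F = "map_poly (\<lambda>c. [:c:]) f"
  have "coeff ?F i \<in> M"
    using assms(4-7)
    by (intro coeff_in_prime_ideal_of_roots[OF M, of Y]) (auto simp: degree_map_poly poly_map_poly_const)
  then show "of_int (coeff f i) \<in> M" by (simp add: coeff_map_poly of_int_poly)
qed

text \<open>Frobenius is injective modulo a prime ideal: (x - y)^(p^k) is congruent to the
  difference of the powers.\<close>

lemma mem_prime_ideal_of_frobenius:
  assumes M: "is_prime_ideal M" and p: "prime p" "of_nat p \<in> M"
    and xy: "x ^ (p ^ k) - y ^ (p ^ k) \<in> M"
  shows "x - y \<in> M"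
proof -
  have I: "is_ideal M" using M by (simp add: is_prime_ideal_def)
  have "x ^ (p ^ k) - ((x - y) ^ (p ^ k) + y ^ (p ^ k)) \<in> M"
    using freshmans_dream_ideal[OF I p, of "x - y" y k] by simp
  from is_ideal_diff[OF I xy this] have "(x - y) ^ (p ^ k) \<in> M" by simp
  then show ?thesis by (rule prime_ideal_power[OF M])
qed

section \<open>Index of an ideal and the factors X^(p^i) - X\<close>

primrec digit_polys :: "nat \<Rightarrow> nat \<Rightarrow> int poly set"
  where "digit_polys p 0 = {0}"
  | "digit_polys p (Suc n) = (\<lambda>(c, f). pCons c f) ` ({0..<int p} \<times> digit_polys p n)"

lemma finite_digit_polys: "finite (digit_polys p n)"
  and card_digit_polys: "card (digit_polys p n) = p ^ n"
proof (induction n)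
  case (Suc n)
  case 2
  have "inj_on (\<lambda>(c, f). pCons c f) ({0..<int p} \<times> digit_polys p n)" by (auto simp: inj_on_def)
  then show ?case using Suc by (simp add: card_image card_cartesian_product)
qed auto

lemma coeff_digit_polys:
  "f \<in> digit_polys p n \<Longrightarrow> i < n \<Longrightarrow> coeff f i \<in> {0..<int p}"
  "f \<in> digit_polys p n \<Longrightarrow> i \<ge> n \<Longrightarrow> coeff f i = 0"
proof (induction n arbitrary: f i)
  case (Suc n)
  {
    case 1
    then show ?case using Suc.IH by (cases i) auto
  next
    case 2
    then show ?case using Suc.IH by (cases i) auto
  }
qed auto

text \<open>A difference h of two such polynomials has degree below \<open>e\<close>. If h lies in
  \<open>M\<close>, then X is a root of h modulo \<open>M\<close>, hence so are the \<open>e\<close>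
  powers X^(p^i) with i < e, which are pairwise incongruent by the hypothesis. So \<open>p\<close>
  divides all coefficients of h, and digits in {0..<p} that agree modulo \<open>p\<close> are
  equal.\<close>

lemma incongruent_digit_polys:
  assumes M: "is_prime_ideal M" and p: "prime p" "of_nat p \<in> M"
    and e: "\<And>j. 0 < j \<Longrightarrow> j < e \<Longrightarrow> poly_X ^ (p ^ j) - poly_X \<notin> M"
  shows "incongruent M (digit_polys p e)"
  unfolding incongruent_def
proof (intro ballI impI)
  have I: "is_ideal M" using M by (simp add: is_prime_ideal_def)
  fix f g assume fg: "f \<in> digit_polys p e" "g \<in> digit_polys p e" "f - g \<in> M"
  define h where "h = f - g"
  show "f = g"
  proof (cases "e = 0")
    case True
    then show ?thesis using fg by simp
  next
    case False
    let ?Y = "(\<lambda>i. poly_X ^ (p ^ i)) ` {..<e}"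
    \<comment> \<open>Injectivity of Frobenius cancels the common power p^i and leaves X^(p^(j-i)) -
      X, which is excluded.\<close>
    have ne: "poly_X ^ (p ^ j) - poly_X ^ (p ^ i) \<notin> M" if "i < j" "j < e" for i j
    proof
      assume *: "poly_X ^ (p ^ j) - poly_X ^ (p ^ i) \<in> M"
      have "p ^ j = p ^ (j - i) * p ^ i" using that by (simp flip: power_add)
      then have "(poly_X ^ (p ^ (j - i))) ^ (p ^ i) - poly_X ^ (p ^ i) \<in> M" using * by (simp flip: power_mult)
      from mem_prime_ideal_of_frobenius[OF M p this] show False using e[of "j - i"] that by simp
    qed
    have ne': "poly_X ^ (p ^ j) - poly_X ^ (p ^ i) \<notin> M" if "i \<noteq> j" "i < e" "j < e" for i j
      using ne[of i j] ne[of j i] ideal_cong_sym[OF I] that by (metis linorder_neqE_nat)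
    have "incongruent M ?Y"
      unfolding incongruent_def
    proof (intro ballI impI; elim imageE)
      fix x y i j assume *: "x - y \<in> M" "x = poly_X ^ p ^ i" "y = poly_X ^ p ^ j" "i \<in> {..<e}" "j \<in> {..<e}"
      then have "i = j" using ne'[of j i] by (cases "i = j") simp_all
      then show "x = y" using * by simp
    qed
    moreover have "inj_on (\<lambda>i. poly_X ^ (p ^ i)) {..<e}"
    proof (rule inj_onI)
      fix i j assume *: "i \<in> {..<e}" "j \<in> {..<e}" "poly_X ^ p ^ i = poly_X ^ p ^ j"
      then have "poly_X ^ p ^ i - poly_X ^ p ^ j \<in> M" using is_ideal_zero[OF I] by simp
      then show "i = j" using ne'[of j i] * by (cases "i = j") simp_all
    qed
    then have "card ?Y = e" by (simp add: card_image)
    moreover have "degree h < e"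
      using False coeff_digit_polys(2)[OF fg(1)] coeff_digit_polys(2)[OF fg(2)]
      by (intro degree_lessI) (auto simp: h_def)
    moreover have "pcompose h y \<in> M" if y: "y \<in> ?Y" for y
    proof -
      obtain i where i: "y = poly_X ^ (p ^ i)" using y by blast
      have hx: "pcompose h poly_X = h" unfolding poly_X_def by (rule pcompose_idR)
      have "h ^ (p ^ i) \<in> M"
        using fg(3) prime_gt_0_nat[OF p(1)] unfolding h_def
        by (intro is_ideal_dvd[OF I fg(3)] dvd_power) auto
      moreover have "pcompose h (poly_X ^ (p ^ i)) - h ^ (p ^ i) \<in> M"
        using pcompose_frobenius_ideal[OF I p, of h poly_X i] unfolding hx .
      ultimately have "pcompose h (poly_X ^ (p ^ i)) \<in> M"
        using is_ideal_add[OF I] by fastforce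
      then show ?thesis by (simp add: i)
    qed
    ultimately have "int p dvd coeff h i" for i
      using dvd_coeff_of_roots[OF M p, of ?Y h] by simp
    then have d: "int p dvd coeff f i - coeff g i" for i by (simp add: h_def)
    show "f = g"
    proof (rule poly_eqI)
      fix i
      show "coeff f i = coeff g i"
      proof (cases "i < e")
        case True
        then show ?thesis
          using coeff_digit_polys(1)[OF fg(1) True] coeff_digit_polys(1)[OF fg(2) True] d[of i]
          by (auto simp: mod_eq_dvd_iff[symmetric])
      next
        case False
        then show ?thesis using coeff_digit_polys(2) fg by simp
      qed
    qed
  qed
qed

text \<open>Without any period the digit polynomials of length \<open>B\<close> would be p^B > B
  incongruent elements. The least period \<open>e\<close> then makes those of length
  \<open>e\<close> incongruent, which bounds p^e.\<close>

lemma prime_ideal_frobenius_period: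
  assumes M: "is_prime_ideal M" and p: "prime p" "of_nat p \<in> M"
    and bd: "\<And>S. finite S \<Longrightarrow> incongruent M S \<Longrightarrow> card S < B"
  obtains e where "e > 0" "poly_X ^ (p ^ e) - poly_X \<in> M" "p ^ e < B" "incongruent M (digit_polys p e)"
proof -
  have "\<exists>e>0. poly_X ^ (p ^ e) - poly_X \<in> M"
  proof (rule ccontr)
    assume "\<not> ?thesis"
    then have "incongruent M (digit_polys p B)"
      using incongruent_digit_polys[OF M p] by blast
    then have "p ^ B < B" using bd finite_digit_polys card_digit_polys by metis
    moreover have "B < p ^ B" using prime_gt_1_nat[OF p(1)] by (simp add: power_gt_expt)
    ultimately show False by simp
  qed
  then have ex: "\<exists>e. e > 0 \<and> poly_X ^ (p ^ e) - poly_X \<in> M" by blast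
  define e where "e = (LEAST e. e > 0 \<and> poly_X ^ (p ^ e) - poly_X \<in> M)"
  have e: "e > 0" "poly_X ^ (p ^ e) - poly_X \<in> M" using LeastI_ex[OF ex] by (auto simp: e_def)
  have "poly_X ^ (p ^ j) - poly_X \<notin> M" if "0 < j" "j < e" for j
    using not_less_Least[of j "\<lambda>e. e > 0 \<and> poly_X ^ (p ^ e) - poly_X \<in> M"] that by (auto simp: e_def)
  then have "incongruent M (digit_polys p e)" by (rule incongruent_digit_polys[OF M p])
  then show thesis using that e bd finite_digit_polys card_digit_polys by metis
qed

text \<open>Induction on the index of \<open>I\<close>: choose a prime ideal \<open>M\<close> above \<open>I\<close> and let \<open>e\<close> be least with
  \<open>u = X ^ (p ^ e) - X\<close> in \<open>M\<close>. Passing to the ideal quotient \<open>(I : u)\<close> divides the index by at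
  least \<open>p ^ e\<close>.\<close>

lemma prod_frobenius_mem_ideal:
  fixes I :: "int poly set"
  assumes p: "prime p"
    and "is_ideal I" "of_nat p \<in> I"
    and "\<And>S. finite S \<Longrightarrow> incongruent I S \<Longrightarrow> card S < p ^ Suc d"
    and "d \<le> D"
  shows "\<exists>c. (\<Sum>i=1..D. c i * i) \<le> d \<and> (\<Prod>i=1..D. (poly_X ^ (p ^ i) - poly_X) ^ c i) \<in> I"
  using assms(2-5)
proof (induction d arbitrary: I rule: less_induct)
  case (less d)
  note I = less.prems(1) and pI = less.prems(2)
  show ?case
  proof (cases "1 \<in> I")
    case True
    then show ?thesis by (intro exI[of _ "\<lambda>_. 0"]) simp
  next
    case False
    then obtain M where M: "is_prime_ideal M" "I \<subseteq> M" using prime_ideal_above[OF I] by blast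
    then have iM: "is_ideal M" by (simp add: is_prime_ideal_def)
    have bd: "card S < p ^ Suc d" if "finite S" "incongruent M S" for S
    proof (rule less.prems(3)[OF that(1)])
      show "incongruent I S" using that(2) M(2) unfolding incongruent_def by blast
    qed
    obtain e where e: "e > 0" "poly_X ^ (p ^ e) - poly_X \<in> M" "p ^ e < p ^ Suc d"
        "incongruent M (digit_polys p e)"
      using prime_ideal_frobenius_period[OF M(1) p, of "p ^ Suc d"] pI M(2) bd by blast
    have ed: "e \<le> d" using e(3) prime_gt_1_nat[OF p] by (simp only: power_strict_increasing_iff)
    define u where "u = poly_X ^ (p ^ e) - poly_X"
    define J where "J = {x. u * x \<in> I}"
    have J: "is_ideal J"
      unfolding is_ideal_def J_def
      using is_ideal_zero[OF I] is_ideal_add[OF I] is_ideal_mult[OF I]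
      by (auto simp: distrib_left mult.left_commute)
    have pJ: "of_nat p \<in> J" unfolding J_def using is_ideal_mult[OF I pI] by simp
    have cardS: "card S < p ^ Suc (d - e)" if S: "finite S" "incongruent J S" for S
    proof -
      \<comment> \<open>Since \<open>u\<close> lies in \<open>M\<close>, a sum a + u s determines
        \<open>a\<close> modulo \<open>M\<close>, hence \<open>a\<close> itself; then u s modulo
        \<open>I\<close> determines \<open>s\<close> modulo \<open>J\<close>. The sums are therefore
        p^e * card S incongruent elements modulo \<open>I\<close>.\<close>
      let ?f = "\<lambda>(a, s). a + u * s"
      let ?P = "digit_polys p e \<times> S"
      have eq: "a = a' \<and> s = s'"
        if *: "a \<in> digit_polys p e" "s \<in> S" "a' \<in> digit_polys p e" "s' \<in> S"
          "(a + u * s) - (a' + u * s') \<in> I" for a s a' s'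
      proof -
        have "u * (s' - s) \<in> M" using e(2) is_ideal_mult'[OF iM] by (simp add: u_def)
        moreover have "(a + u * s) - (a' + u * s') \<in> M" using * M(2) by blast
        ultimately have "((a + u * s) - (a' + u * s')) + u * (s' - s) \<in> M"
          using is_ideal_add[OF iM] by blast
        then have "a - a' \<in> M" by (simp add: algebra_simps)
        then have "a = a'" using e(4) * by (simp add: incongruent_def)
        then have "u * (s - s') \<in> I" using * by (simp add: algebra_simps)
        then have "s - s' \<in> J" by (simp add: J_def)
        then show ?thesis using \<open>a = a'\<close> S(2) * by (simp add: incongruent_def)
      qed
      have "incongruent I (?f ` ?P)"
        unfolding incongruent_def using eq by auto
      then have "card (?f ` ?P) < p ^ Suc d"
        using S(1) finite_digit_polys by (intro less.prems(3)) auto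
      moreover have "inj_on ?f ?P"
      proof (rule inj_onI; clarify)
        fix a s a' s' assume *: "a \<in> digit_polys p e" "s \<in> S" "a' \<in> digit_polys p e" "s' \<in> S"
          "a + u * s = a' + u * s'"
        then have "(a + u * s) - (a' + u * s') \<in> I" using is_ideal_zero[OF I] by simp
        from eq[OF *(1-4) this] show "a = a' \<and> s = s'" .
      qed
      then have "card (?f ` ?P) = p ^ e * card S"
        by (simp add: card_image card_cartesian_product card_digit_polys)
      moreover have "p ^ Suc d = p ^ e * p ^ Suc (d - e)"
        using ed by (simp only: power_add[symmetric]) simp
      ultimately show ?thesis using prime_gt_0_nat[OF p] by (simp only: mult_less_cancel1)
    qed
    \<comment> \<open>The range \<open>D\<close> stays fixed while \<open>d\<close> drops to d - e,
      so both products have the same factors and only the exponent at \<open>e\<close> grows by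
      one.\<close>
    obtain c where c: "(\<Sum>i=1..D. c i * i) \<le> d - e" "(\<Prod>i=1..D. (poly_X ^ (p ^ i) - poly_X) ^ c i) \<in> J"
      using less.IH[OF _ J pJ cardS] e(1) ed less.prems(4) by force
    define c' where "c' = c(e := Suc (c e))"
    have eD: "e \<in> {1..D}" using e(1) ed less.prems(4) by auto
    have "(\<Sum>i\<in>{1..D} - {e}. c' i * i) = (\<Sum>i\<in>{1..D} - {e}. c i * i)"
      by (intro sum.cong) (auto simp: c'_def)
    then have "(\<Sum>i=1..D. c' i * i) = e + (\<Sum>i=1..D. c i * i)"
      unfolding sum.remove[OF finite_atLeastAtMost eD] by (simp add: c'_def)
    moreover have "(\<Prod>i\<in>{1..D} - {e}. (poly_X ^ (p ^ i) - poly_X) ^ c' i)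
        = (\<Prod>i\<in>{1..D} - {e}. (poly_X ^ (p ^ i) - poly_X) ^ c i)"
      by (intro prod.cong) (auto simp: c'_def)
    then have "(\<Prod>i=1..D. (poly_X ^ (p ^ i) - poly_X) ^ c' i)
        = u * (\<Prod>i=1..D. (poly_X ^ (p ^ i) - poly_X) ^ c i)"
      unfolding prod.remove[OF finite_atLeastAtMost eD] by (simp add: c'_def u_def mult.assoc)
    ultimately show ?thesis using c ed by (intro exI[of _ c']) (simp add: J_def)
  qed
qed

section \<open>The polynomial that is hard to separate from zero\<close>

definition witness_poly :: "nat \<Rightarrow> nat \<Rightarrow> nat \<Rightarrow> int poly"
  where "witness_poly p R d =
    (\<Prod>r=1..R. poly_X ^ r - 1) * (\<Prod>i=1..d. (poly_X ^ (p ^ i) - poly_X) ^ (d + 1 - i))"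

lemma witness_poly_mem_of_root:
  assumes "is_ideal I" "poly_X ^ m - 1 \<in> I" "1 \<le> m" "m \<le> R"
  shows "witness_poly p R d \<in> I"
proof (rule is_ideal_dvd[OF assms(1,2)])
  have "(poly_X ^ m - 1) dvd (\<Prod>r=1..R. poly_X ^ r - 1)"
    using assms(3,4) by (intro dvd_prodI) auto
  then show "poly_X ^ m - 1 dvd witness_poly p R d" by (simp add: witness_poly_def)
qed

text \<open>The exponents c_i found for \<open>I\<close> depend on \<open>I\<close>, but each
  satisfies c_i * i \<le> d. For c_i > 0 this gives i + (c_i - 1) \<le> d, so the exponent d + 1 - i
  serves all such ideals at once.\<close>

lemma witness_poly_mem_of_index:
  assumes "prime p" "is_ideal I" "of_nat p \<in> I"
    and "\<And>S. finite S \<Longrightarrow> incongruent I S \<Longrightarrow> card S < p ^ Suc d"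
  shows "witness_poly p R d \<in> I"
proof -
  obtain c where c: "(\<Sum>i=1..d. c i * i) \<le> d" "(\<Prod>i=1..d. (poly_X ^ (p ^ i) - poly_X) ^ c i) \<in> I"
    using prod_frobenius_mem_ideal[OF assms(1-4), of d] by blast
  have "c i \<le> d + 1 - i" if i: "i \<in> {1..d}" for i
  proof (cases "c i")
    case (Suc n)
    have "c i * i \<le> (\<Sum>i=1..d. c i * i)" using i by (intro member_le_sum) auto
    then have "c i * i \<le> d" using c(1) by simp
    moreover have "n \<le> n * i" using i by simp
    moreover have "c i * i = i + n * i" using Suc by simp
    ultimately show ?thesis using Suc by linarith
  qed simp
  then have "(\<Prod>i=1..d. (poly_X ^ (p ^ i) - poly_X) ^ c i) dvd
      (\<Prod>i=1..d. (poly_X ^ (p ^ i) - poly_X) ^ (d + 1 - i))"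
    by (intro prod_dvd_prod le_imp_power_dvd)
  then show ?thesis
    unfolding witness_poly_def by (intro is_ideal_dvd[OF assms(2) c(2)] dvd_mult)
qed

lemma poly_X_power: "poly_X ^ n = monom 1 n"
  by (simp add: poly_X_def monom_altdef)

lemma monic_poly_X_power_diff:
  assumes "degree g < n"
  shows "degree (poly_X ^ n - g) = n" "lead_coeff (poly_X ^ n - g) = 1"
proof -
  have "degree (poly_X ^ n) = n" by (simp add: poly_X_power degree_monom_eq)
  then show "degree (poly_X ^ n - g) = n"
    using degree_add_eq_left[of "- g" "poly_X ^ n"] assms by simp
  then show "lead_coeff (poly_X ^ n - g) = 1"
    using assms by (simp add: poly_X_power coeff_eq_0)
qed

lemma degree_poly_X: "degree poly_X = 1"
  by (simp add: poly_X_def)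

text \<open>Being monic, the polynomial stays nonzero modulo \<open>p\<close> and so gives a
  nontrivial group element.\<close>

lemma lead_coeff_witness_poly:
  assumes "prime p"
  shows "lead_coeff (witness_poly p R d) = 1"
proof -
  have 1: "lead_coeff (poly_X ^ r - 1) = 1" if "r \<in> {1..R}" for r
    using that by (intro monic_poly_X_power_diff(2)) auto
  have 2: "lead_coeff ((poly_X ^ (p ^ i) - poly_X) ^ (d + 1 - i)) = 1" if "i \<in> {1..d}" for i
  proof -
    have "degree poly_X < p ^ i"
      using that prime_gt_1_nat[OF assms] by (simp add: degree_poly_X one_less_power del: One_nat_def)
    then show ?thesis by (simp only: lead_coeff_power monic_poly_X_power_diff(2) power_one)
  qed
  show ?thesis
    unfolding witness_poly_def lead_coeff_mult lead_coeff_prod using 1 2 by simp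
qed

text \<open>The weights d + 1 - i are large only where p^i is small, so the weighted sum is still of
  order p^d. Each of the two nested geometric summations costs a factor 2, because p \<ge>
  2.\<close>

lemma degree_witness_poly:
  assumes "prime p"
  shows "degree (witness_poly p R d) \<le> R * R + 4 * p ^ d"
proof -
  have p2: "p \<ge> 2" using prime_ge_2_nat[OF assms] .
  have g: "(\<Sum>i=1..d. p ^ i) \<le> 2 * p ^ d" for d
  proof (induction d)
    case (Suc d)
    have "2 * p ^ d \<le> p ^ Suc d" using p2 by simp
    moreover have "(\<Sum>i=1..Suc d. p ^ i) = (\<Sum>i=1..d. p ^ i) + p ^ Suc d" by simp
    ultimately show ?case using Suc by linarith
  qed simp
  have s: "(\<Sum>i=1..d. (d + 1 - i) * p ^ i) \<le> 4 * p ^ d" for d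
  proof (induction d)
    case (Suc d)
    \<comment> \<open>Raising d by one raises every weight by one, which adds a plain geometric
      sum.\<close>
    have "(\<Sum>i=1..d. (Suc d + 1 - i) * p ^ i) = (\<Sum>i=1..d. (d + 1 - i) * p ^ i + p ^ i)"
      by (intro sum.cong) (auto simp: Suc_diff_le)
    then have "(\<Sum>i=1..Suc d. (Suc d + 1 - i) * p ^ i)
        = (\<Sum>i=1..d. (d + 1 - i) * p ^ i) + (\<Sum>i=1..Suc d. p ^ i)"
      by (simp add: sum.distrib)
    also have "\<dots> \<le> 4 * p ^ d + 2 * p ^ Suc d" using Suc g[of "Suc d"] by (rule add_mono)
    also have "\<dots> \<le> 4 * p ^ Suc d" using p2 by simp
    finally show ?case .
  qed simp
  have "degree (\<Prod>r=1..R. poly_X ^ r - 1) \<le> (\<Sum>r=1..R. degree (poly_X ^ r - 1))"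
    using degree_prod_sum_le[of "{1..R}" "\<lambda>r. poly_X ^ r - 1"] by (simp add: comp_def)
  also have "\<dots> = (\<Sum>r=1..R. r)"
    by (intro sum.cong monic_poly_X_power_diff(1)) auto
  also have "\<dots> \<le> R * R" using sum_bounded_above[of "{1..R}" "\<lambda>r. r" R] by simp
  finally have 1: "degree (\<Prod>r=1..R. poly_X ^ r - 1) \<le> R * R" .
  have "degree ((poly_X ^ (p ^ i) - poly_X) ^ (d + 1 - i)) \<le> (d + 1 - i) * p ^ i" if "i \<in> {1..d}" for i
  proof -
    have "degree poly_X < p ^ i"
      using that p2 by (simp add: degree_poly_X one_less_power del: One_nat_def)
    from monic_poly_X_power_diff(1)[OF this] show ?thesis
      using degree_power_le[of "poly_X ^ (p ^ i) - poly_X" "d + 1 - i"] by (simp add: mult.commute)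
  qed
  then have "(\<Sum>i=1..d. degree ((poly_X ^ (p ^ i) - poly_X) ^ (d + 1 - i))) \<le> 4 * p ^ d"
    using order.trans[OF sum_mono s[of d]] by simp
  then have 2: "degree (\<Prod>i=1..d. (poly_X ^ (p ^ i) - poly_X) ^ (d + 1 - i)) \<le> 4 * p ^ d"
    using degree_prod_sum_le[of "{1..d}" "\<lambda>i. (poly_X ^ (p ^ i) - poly_X) ^ (d + 1 - i)"]
    by (simp add: comp_def)
  show ?thesis
    unfolding witness_poly_def using degree_mult_le order.trans add_mono[OF 1 2] by blast
qed

section \<open>Small quotient fields that separate a given polynomial\<close>

lemma incongruent_representatives:
  assumes "is_ideal J" and B: "\<And>S. finite S \<Longrightarrow> incongruent J S \<Longrightarrow> card S \<le> B"
  shows "\<exists>Q. finite Q \<and> card Q \<le> B \<and> (\<forall>x. \<exists>r\<in>Q. x - r \<in> J)"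
proof -
  let ?P = "\<lambda>S. finite S \<and> incongruent J S"
  have "?P {}" by (simp add: incongruent_def)
  then obtain S where S: "?P S" and max: "\<And>T. ?P T \<Longrightarrow> card T \<le> card S"
    using ex_has_greatest_nat[of ?P "{}" card "Suc B"] B le_imp_less_Suc by blast
  have "\<exists>r\<in>S. x - r \<in> J" for x
  proof (rule ccontr)
    assume *: "\<not> ?thesis"
    then have x: "x \<notin> S" using is_ideal_zero[OF assms(1)] by force
    have "incongruent J (insert x S)"
      using S * ideal_cong_sym[OF assms(1)] unfolding incongruent_def by blast
    then show False using max[of "insert x S"] S x by simp
  qed
  then show ?thesis using S B by blast
qed

text \<open>For m > 0 this is the constant coefficient of f reduced modulo X^m - 1. Stopping at the
  degree loses nothing then, since j \<le> j * m.\<close>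

definition periodic_sum :: "nat \<Rightarrow> int poly \<Rightarrow> int"
  where "periodic_sum m f = (\<Sum>j\<le>degree f. coeff f (j * m))"

lemma periodic_sum_eq:
  assumes "m > 0" "degree f \<le> N"
  shows "periodic_sum m f = (\<Sum>j\<le>N. coeff f (j * m))"
  unfolding periodic_sum_def
proof (rule sum.mono_neutral_left)
  show "\<forall>j\<in>{..N} - {..degree f}. coeff f (j * m) = 0"
  proof
    fix j assume "j \<in> {..N} - {..degree f}"
    moreover have "j \<le> j * m" using assms(1) by simp
    ultimately have "degree f < j * m" by (metis DiffE atMost_iff le_trans not_le)
    then show "coeff f (j * m) = 0" by (rule coeff_eq_0)
  qed
qed (use assms in auto)

lemma periodic_sum_add:
  assumes "m > 0"
  shows "periodic_sum m (f + g) = periodic_sum m f + periodic_sum m g"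
  using degree_add_le_max[of f g]
  by (simp add: periodic_sum_eq[OF assms, where N = "max (degree f) (degree g)"] sum.distrib)

lemma periodic_sum_shift:
  assumes "m > 0"
  shows "periodic_sum m (poly_X ^ m * f) = periodic_sum m f"
proof -
  have "degree (poly_X ^ m * f) \<le> Suc (degree f + m)"
    using degree_mult_le[of "poly_X ^ m" f] by (simp add: poly_X_power degree_monom_eq)
  then have "periodic_sum m (poly_X ^ m * f) = (\<Sum>j\<le>Suc (degree f + m). coeff (poly_X ^ m * f) (j * m))"
    by (rule periodic_sum_eq[OF assms])
  also have "\<dots> = (\<Sum>j\<le>degree f + m. coeff f (j * m))"
    using assms by (subst sum.atMost_Suc_shift) (simp add: poly_X_power coeff_monom_mult)
  also have "\<dots> = periodic_sum m f" by (rule periodic_sum_eq[OF assms, symmetric]) simp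
  finally show ?thesis .
qed

text \<open>For m > 0 this is the ideal generated by p and X^m - 1, described as the radical of the
  bilinear form that takes the constant coefficient of a product modulo X^m - 1. Non-membership can
  thus be shown by exhibiting one multiplier, without any division.\<close>

definition periodic_ideal :: "nat \<Rightarrow> nat \<Rightarrow> int poly set"
  where "periodic_ideal p m = {f. \<forall>g. int p dvd periodic_sum m (g * f)}"

lemma periodic_ideal:
  assumes "m > 0"
  shows "is_ideal (periodic_ideal p m)" "of_nat p \<in> periodic_ideal p m"
    "poly_X ^ m - 1 \<in> periodic_ideal p m"
proof -
  note add = periodic_sum_add[OF assms]
  have "periodic_sum m 0 = 0" by (simp add: periodic_sum_def)
  then show "is_ideal (periodic_ideal p m)"
    unfolding is_ideal_def periodic_ideal_def
    by (simp add: distrib_left add flip: mult.assoc)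
  have "periodic_sum m (g * of_nat n) = int n * periodic_sum m g" for g n
    by (induction n) (simp_all add: \<open>periodic_sum m 0 = 0\<close> distrib_left distrib_right add)
  then show "of_nat p \<in> periodic_ideal p m" by (simp add: periodic_ideal_def)
  have "periodic_sum m (g * (poly_X ^ m - 1)) = 0" for g
    using add[of "g * (poly_X ^ m - 1)" g] periodic_sum_shift[OF assms, of g]
    by (simp add: algebra_simps)
  then show "poly_X ^ m - 1 \<in> periodic_ideal p m" by (simp add: periodic_ideal_def)
qed

text \<open>The multiplier X^(m-i) moves the i-th coefficient to exponent m. The shifted exponents
  lie strictly between 0 and 2m, so no other coefficient enters the periodic sum.\<close>

lemma not_mem_periodic_ideal:
  assumes "degree f < m" "\<not> int p dvd coeff f i"
  shows "f \<notin> periodic_ideal p m"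
proof -
  have i: "i < m" using assms by (metis coeff_eq_0 dvd_0_right le_less_trans not_le)
  let ?g = "poly_X ^ (m - i) * f"
  have "periodic_sum m ?g = (\<Sum>j\<le>Suc (degree ?g). coeff ?g (j * m))"
    using i by (intro periodic_sum_eq) auto
  also have "\<dots> = (\<Sum>j\<in>{1}. coeff ?g (j * m))"
  proof (intro sum.mono_neutral_right ballI)
    fix j assume j: "j \<in> {..Suc (degree ?g)} - {1}"
    show "coeff ?g (j * m) = 0"
    proof (cases j)
      case 0
      then show ?thesis using i by (simp add: poly_X_power coeff_monom_mult)
    next
      case (Suc n)
      then obtain l where "j = Suc (Suc l)" using j by (cases n) auto
      then have "degree f < j * m - (m - i)" using assms(1) by simp
      then show ?thesis by (simp add: poly_X_power coeff_monom_mult coeff_eq_0)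
    qed
  qed auto
  also have "\<dots> = coeff f i" using i by (simp add: poly_X_power coeff_monom_mult)
  finally have "\<not> int p dvd periodic_sum m ?g" using assms(2) by simp
  then show ?thesis unfolding periodic_ideal_def by blast
qed

text \<open>An ideal maximal among those avoiding \<open>f\<close> is prime here because every element of the
  quotient satisfies \<open>x ^ q = x\<close>, so that \<open>x ^ (q - 1)\<close> is idempotent; the quotient is then a
  field of at most \<open>q\<close> elements. This replaces the construction of the field with \<open>q\<close> elements.\<close>

lemma separating_ideal:
  assumes p: "prime p" and k: "k > 0" and m: "m = p ^ k - 1"
    and f: "degree f < m" "\<not> int p dvd coeff f i"
  obtains J where "is_ideal J" "of_nat p \<in> J" "poly_X ^ m - 1 \<in> J" "f \<notin> J"
    "\<exists>Q. finite Q \<and> card Q \<le> p ^ k \<and> (\<forall>x. \<exists>r\<in>Q. x - r \<in> J)"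
proof -
  define q where "q = p ^ k"
  have q2: "q \<ge> 2" using p k prime_gt_1_nat[of p] one_less_power[of p k] by (simp add: q_def)
  have m0: "m > 0" using f by simp
  obtain J where J: "is_ideal J" "periodic_ideal p m \<subseteq> J" "f \<notin> J"
      "\<And>x. x \<notin> J \<Longrightarrow> \<exists>r. f - r * x \<in> J"
    using ideal_maximal_avoiding[OF periodic_ideal(1)[OF m0] not_mem_periodic_ideal[OF f]] by blast
  note I = J(1)
  have pJ: "of_nat p \<in> J" and XJ: "poly_X ^ m - 1 \<in> J" using periodic_ideal[OF m0] J(2) by auto
  have Xq: "poly_X ^ q - poly_X \<in> J"
  proof -
    have "poly_X * (poly_X ^ m - 1) \<in> J" using XJ by (rule is_ideal_mult[OF I])
    also have "poly_X * (poly_X ^ m - 1) = poly_X ^ Suc m - poly_X" by (simp add: algebra_simps)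
    also have "Suc m = q" using q2 by (simp add: m q_def)
    finally show ?thesis .
  qed
  \<comment> \<open>Constants and X are fixed by the q-th power modulo \<open>J\<close>, and that
    power is additive and multiplicative.\<close>
  have frob: "x ^ q - x \<in> J" for x
  proof (induction x)
    case 0
    then show ?case using q2 is_ideal_zero[OF I] by (simp add: zero_power)
  next
    case (pCons a x)
    have e: "pCons a x = of_int a + poly_X * x" by (simp add: poly_X_def of_int_poly)
    have "(of_int a + poly_X * x) ^ q - (of_int a ^ q + (poly_X * x) ^ q) \<in> J"
      unfolding q_def by (rule freshmans_dream_ideal[OF I p pJ])
    moreover have "(of_int a ^ q + (poly_X * x) ^ q) - (of_int a + poly_X * x) \<in> J"
      unfolding power_mult_distrib
      using of_int_frobenius_ideal[OF I p pJ, of a k] Xq pCons.IH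
      by (intro ideal_cong_add[OF I] ideal_cong_mult[OF I]) (simp_all add: q_def)
    ultimately show ?case unfolding e by (rule ideal_cong_trans[OF I])
  qed
  have unit: "1 - x ^ (q - 1) \<in> J" if x: "x \<notin> J" for x
  proof (rule ccontr)
    assume ne: "1 - x ^ (q - 1) \<notin> J"
    define e where "e = x ^ (q - 1)"
    obtain r s where r: "f - r * x \<in> J" and s: "f - s * (1 - e) \<in> J"
      using J(4)[OF x] J(4)[OF ne] by (auto simp: e_def)
    have ex: "e * x - x \<in> J"
      using frob[of x] q2 by (simp add: e_def flip: power_Suc2)
    have "x ^ (q - 2) * (e * x - x) \<in> J" using ex by (rule is_ideal_mult[OF I])
    also have "x ^ (q - 2) * (e * x - x) = e * (x ^ (q - 2) * x) - x ^ (q - 2) * x"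
      by (simp add: algebra_simps)
    also have "x ^ (q - 2) * x = e"
      using q2 by (simp add: e_def Suc_diff_Suc numeral_2_eq_2 flip: power_Suc2)
    finally have ee: "e * e - e \<in> J" .
    \<comment> \<open>By maximality \<open>f\<close> is a multiple of x and also of 1 - e modulo
      \<open>J\<close>. The first kills (1 - e) f and the second kills e f, and these two add up to
      \<open>f\<close>.\<close>
    have "e * (f - s * (1 - e)) - s * (e * e - e) \<in> J"
      by (rule is_ideal_diff[OF I is_ideal_mult[OF I s] is_ideal_mult[OF I ee]])
    moreover have "(1 - e) * (f - r * x) - r * (e * x - x) \<in> J"
      by (rule is_ideal_diff[OF I is_ideal_mult[OF I r] is_ideal_mult[OF I ex]])
    ultimately have "(e * (f - s * (1 - e)) - s * (e * e - e))
        + ((1 - e) * (f - r * x) - r * (e * x - x)) \<in> J" by (rule is_ideal_add[OF I])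
    then show False using J(3) by (simp add: algebra_simps)
  qed
  have prime: "is_prime_ideal J"
    unfolding is_prime_ideal_def
  proof (intro conjI allI impI)
    show "1 \<notin> J" using J(3) is_ideal_mult[OF I, of 1 f] by auto
    fix x y assume xy: "x * y \<in> J"
    show "x \<in> J \<or> y \<in> J"
    proof (rule disjCI)
      assume "y \<notin> J"
      then have "(1 - y ^ (q - 1)) * x \<in> J" using is_ideal_mult'[OF I unit] by blast
      moreover have "y ^ (q - 2) * (x * y) \<in> J" using xy by (rule is_ideal_mult[OF I])
      moreover have "y ^ (q - 1) = y ^ (q - 2) * y"
        using q2 by (simp add: Suc_diff_Suc numeral_2_eq_2 flip: power_Suc2)
      ultimately have "(1 - y ^ (q - 2) * y) * x + y ^ (q - 2) * (x * y) \<in> J"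
        using is_ideal_add[OF I] by simp
      then show "x \<in> J" by (simp add: algebra_simps)
    qed
  qed (rule I)
  have "card S \<le> q" if S: "finite S" "incongruent J S" for S
  proof (rule ccontr)
    assume c: "\<not> card S \<le> q"
    \<comment> \<open>Every element is a root of T^q - T modulo \<open>J\<close>; more than q
      incongruent roots would put its leading coefficient 1 into \<open>J\<close>.\<close>
    let ?F = "monom 1 q - monom 1 1 :: int poly poly"
    have "degree ?F \<le> q" using q2 by (intro degree_diff_le) (auto simp: degree_monom_eq)
    then have "coeff ?F q \<in> J"
      using S c frob
      by (intro coeff_in_prime_ideal_of_roots[OF prime, of S]) (auto simp: poly_monom)
    then show False using prime q2 by (simp add: is_prime_ideal_def)
  qed
  from incongruent_representatives[OF I this] show thesis using that I pJ XJ J(3) by (simp add: q_def)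
qed

section \<open>Words and finite quotients\<close>

definition word_within :: "('a, 'b) monoid_scheme \<Rightarrow> 'a set \<Rightarrow> nat \<Rightarrow> 'a \<Rightarrow> bool"
  where "word_within G X k g \<longleftrightarrow>
    (\<exists>w. set w \<subseteq> X \<union> m_inv G ` X \<and> length w \<le> k \<and> foldr (monoid.mult G) w \<one>\<^bsub>G\<^esub> = g)"

context group
begin

lemma word_within_word_ball:
  assumes "X \<subseteq> carrier G" "g \<in> word_ball G X n"
  shows "\<exists>k. real k \<le> n \<and> word_within G X k g"
proof -
  have "\<exists>k w. set w \<subseteq> X \<union> m_inv G ` X \<and> length w = k \<and> foldr (\<otimes>) w \<one> = g"
    using generate_word[OF assms(1), of g] assms(2) by (simp add: word_ball_def)
  then have "\<exists>w. set w \<subseteq> X \<union> m_inv G ` X \<and> length w = word_length G X g \<and> foldr (\<otimes>) w \<one> = g"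
    unfolding word_length_def by (rule LeastI_ex)
  then have "word_within G X (word_length G X g) g"
    unfolding word_within_def by (metis order_refl)
  then show ?thesis using assms(2) by (auto simp: word_ball_def)
qed

lemma word_ball_word_within:
  assumes "g \<in> generate G X" "word_within G X k g"
  shows "g \<in> word_ball G X (real k)"
proof -
  obtain w where w: "set w \<subseteq> X \<union> m_inv G ` X" "length w \<le> k" "foldr (\<otimes>) w \<one> = g"
    using assms(2) by (auto simp: word_within_def)
  then have "word_length G X g \<le> length w"
    unfolding word_length_def by (intro Least_le) blast
  then show ?thesis using w assms(1) by (simp add: word_ball_def)
qed

lemma word_within_mono: "word_within G X j g \<Longrightarrow> j \<le> k \<Longrightarrow> word_within G X k g"
  unfolding word_within_def by (elim exE) (rule exI, auto)

lemma word_within_one: "word_within G X k \<one>"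
  unfolding word_within_def by (intro exI[of _ "[]"]) simp

lemma foldr_mult_closed:
  "set w \<subseteq> carrier G \<Longrightarrow> foldr (\<otimes>) w \<one> \<in> carrier G"
  by (induction w) auto

lemma foldr_mult_append:
  "set v \<subseteq> carrier G \<Longrightarrow> set w \<subseteq> carrier G \<Longrightarrow>
    foldr (\<otimes>) (v @ w) \<one> = foldr (\<otimes>) v \<one> \<otimes> foldr (\<otimes>) w \<one>"
  by (induction v) (simp_all add: m_assoc foldr_mult_closed del: foldr_append)

lemma word_within_mult:
  assumes "X \<subseteq> carrier G" "word_within G X j g" "word_within G X k h"
  shows "word_within G X (j + k) (g \<otimes> h)"
proof -
  obtain v w where
    v: "set v \<subseteq> X \<union> m_inv G ` X" "length v \<le> j" "foldr (\<otimes>) v \<one> = g" and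
    w: "set w \<subseteq> X \<union> m_inv G ` X" "length w \<le> k" "foldr (\<otimes>) w \<one> = h"
    using assms(2,3) by (auto simp: word_within_def)
  have "X \<union> m_inv G ` X \<subseteq> carrier G" using assms(1) by auto
  then have "foldr (\<otimes>) (v @ w) \<one> = g \<otimes> h"
    using foldr_mult_append[of v w] v w by blast
  then show ?thesis
    unfolding word_within_def using v w by (intro exI[of _ "v @ w"]) simp
qed

lemma word_within_finite:
  assumes X: "X \<subseteq> carrier G" and E: "finite E" "E \<subseteq> generate G X"
  obtains k where "\<And>g. g \<in> E \<Longrightarrow> word_within G X k g"
proof -
  have "\<exists>k. word_within G X k g" if "g \<in> E" for g
    using generate_word[OF X, of g] E that unfolding word_within_def by blast
  then obtain l where l: "\<And>g. g \<in> E \<Longrightarrow> word_within G X (l g) g" by metis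
  have "word_within G X (\<Sum>g\<in>E. l g) g" if "g \<in> E" for g
    using that E(1) by (intro word_within_mono[OF l] member_le_sum) auto
  then show thesis using that by blast
qed

text \<open>The function \<open>c\<close> acts as a homomorphism onto a quotient known only through
  its fibres: equality of values is compatible with multiplication. The fibre of the identity is
  then a normal subgroup, and the value of \<open>c\<close> determines the coset.\<close>

lemma congruence_kernel:
  assumes c: "\<And>x x' y y'. x \<in> carrier G \<Longrightarrow> x' \<in> carrier G \<Longrightarrow> y \<in> carrier G \<Longrightarrow> y' \<in> carrier G \<Longrightarrow>
      c x = c x' \<Longrightarrow> c y = c y' \<Longrightarrow> c (x \<otimes> y) = c (x' \<otimes> y')"
    and fin: "finite (c ` carrier G)"
  defines "N \<equiv> {g \<in> carrier G. c g = c \<one>}"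
  shows "N \<lhd> G" "finite (rcosets N)" "card (rcosets N) \<le> card (c ` carrier G)"
proof -
  have sub: "subgroup N G"
  proof
    show "N \<subseteq> carrier G" "\<one> \<in> N" by (auto simp: N_def)
    show "x \<otimes> y \<in> N" if "x \<in> N" "y \<in> N" for x y
      using that c[of x \<one> y \<one>] by (simp add: N_def)
    show "inv x \<in> N" if "x \<in> N" for x
      using that c[of "inv x" "inv x" x \<one>] by (simp add: N_def)
  qed
  have "x \<otimes> h \<otimes> inv x \<in> N" if "x \<in> carrier G" "h \<in> N" for x h
    using that c[of x x h \<one>] c[of "x \<otimes> h" x "inv x" "inv x"] by (simp add: N_def)
  then show "N \<lhd> G" using sub by (simp add: normal_inv_iff)
  define F where "F k = N #> (SOME g. g \<in> carrier G \<and> c g = k)" for k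
  have "N #> g = F (c g)" if g: "g \<in> carrier G" for g
  proof -
    define h where "h = (SOME h. h \<in> carrier G \<and> c h = c g)"
    have h: "h \<in> carrier G" "c h = c g"
      using someI[of "\<lambda>h. h \<in> carrier G \<and> c h = c g" g] g by (auto simp: h_def)
    have "c (g \<otimes> inv h) = c (h \<otimes> inv h)" using g h by (intro c) auto
    then have "g \<otimes> inv h \<in> N" using g h by (simp add: N_def)
    then have "g \<in> N #> h"
      using subgroup.rcos_module_rev[OF sub is_group h(1) g] by simp
    then show ?thesis using repr_independence[OF _ h(1) sub] by (simp add: F_def h_def)
  qed
  then have sub: "rcosets N \<subseteq> F ` c ` carrier G" by (auto simp: RCOSETS_def)
  then show "finite (rcosets N)" using fin finite_subset by blast
  have "card (rcosets N) \<le> card (F ` c ` carrier G)" using sub fin by (intro card_mono) auto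
  also have "\<dots> \<le> card (c ` carrier G)" using fin by (rule card_image_le)
  finally show "card (rcosets N) \<le> card (c ` carrier G)" .
qed

lemma residual_depth_le:
  "N \<lhd> G \<Longrightarrow> finite (rcosets N) \<Longrightarrow> g \<notin> N \<Longrightarrow> residual_depth G g \<le> card (rcosets N)"
  unfolding residual_depth_def by (rule cInf_lower) auto

text \<open>One separating subgroup must be supplied, since an infimum over an empty set gives no
  lower bound.\<close>

lemma le_residual_depth:
  assumes "N \<lhd> G" "finite (rcosets N)" "g \<notin> N"
    and "\<And>N. N \<lhd> G \<Longrightarrow> finite (rcosets N) \<Longrightarrow> g \<notin> N \<Longrightarrow> k \<le> card (rcosets N)"
  shows "k \<le> residual_depth G g"
  unfolding residual_depth_def using assms by (intro cInf_greatest) auto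

end

section \<open>Coordinates in the lamplighter group and polynomial lamp configurations\<close>

lemma lamplighter_carrier:
  assumes "p > 0"
  shows "(a, b) \<in> carrier (lamplighter p) \<longleftrightarrow> (\<forall>i. a i \<in> {0..<int p}) \<and> finite {i. a i \<noteq> 0}"
  using assms
  by (simp add: lamplighter_def semidirect_product_def carrier_sum_group carrier_integer_mod_group PiE_iff)

lemma restrict_UNIV: "restrict f UNIV = f"
  by (simp add: fun_eq_iff)

lemma lamplighter_mult:
  "(a, b) \<otimes>\<^bsub>lamplighter p\<^esub> (a', b') = (\<lambda>i. (a i + a' (b + i)) mod int p, b + b')"
  by (simp add: lamplighter_def semidirect_product_def mult_integer_mod_group shift_def restrict_UNIV)

lemma lamplighter_one: "\<one>\<^bsub>lamplighter p\<^esub> = (\<lambda>_. 0, 0)"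
  by (simp add: lamplighter_def semidirect_product_def restrict_UNIV)

lemma lamplighter_inv:
  assumes "p > 0" "(a, b) \<in> carrier (lamplighter p)"
  shows "inv\<^bsub>lamplighter p\<^esub> (a, b) = (\<lambda>i. (- a (i - b)) mod int p, - b)"
proof (rule group.inv_equality[OF group_lamplighter])
  let ?y = "(\<lambda>i. (- a (i - b)) mod int p, - b)"
  show "?y \<otimes>\<^bsub>lamplighter p\<^esub> (a, b) = \<one>\<^bsub>lamplighter p\<^esub>"
    by (simp add: lamplighter_mult lamplighter_one mod_simps add.commute)
  have "finite {i. (- a (i - b)) mod int p \<noteq> 0}"
  proof (rule finite_subset)
    show "{i. (- a (i - b)) mod int p \<noteq> 0} \<subseteq> (\<lambda>i. i + b) ` {i. a i \<noteq> 0}"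
    proof
      fix i assume "i \<in> {i. (- a (i - b)) mod int p \<noteq> 0}"
      then have "a (i - b) \<noteq> 0" by auto
      then show "i \<in> (\<lambda>i. i + b) ` {i. a i \<noteq> 0}" by (intro image_eqI[of _ _ "i - b"]) auto
    qed
    show "finite ((\<lambda>i. i + b) ` {i. a i \<noteq> 0})" using assms by (simp add: lamplighter_carrier)
  qed
  then show "?y \<in> carrier (lamplighter p)" using assms(1) by (simp add: lamplighter_carrier)
qed fact

definition poly_seq :: "nat \<Rightarrow> int poly \<Rightarrow> int \<Rightarrow> int"
  where "poly_seq p f = (\<lambda>i. if i < 0 then 0 else coeff f (nat i) mod int p)"

lemma poly_seq_carrier:
  assumes "p > 0"
  shows "(poly_seq p f, b) \<in> carrier (lamplighter p)"
proof -
  have "{i. poly_seq p f i \<noteq> 0} \<subseteq> int ` {..degree f}"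
  proof
    fix i assume "i \<in> {i. poly_seq p f i \<noteq> 0}"
    then have "i \<ge> 0" "coeff f (nat i) \<noteq> 0" by (auto simp: poly_seq_def split: if_splits)
    then show "i \<in> int ` {..degree f}" by (intro image_eqI[of _ _ "nat i"]) (auto intro: le_degree)
  qed
  then have "finite {i. poly_seq p f i \<noteq> 0}" by (rule finite_subset) simp
  moreover have "poly_seq p f i \<in> {0..<int p}" for i using assms by (simp add: poly_seq_def)
  ultimately show ?thesis using assms by (simp add: lamplighter_carrier)
qed

lemma poly_seq_0: "poly_seq p 0 = (\<lambda>_. 0)"
  by (auto simp: poly_seq_def)

lemma poly_seq_add:
  "(poly_seq p f, 0) \<otimes>\<^bsub>lamplighter p\<^esub> (poly_seq p g, b) = (poly_seq p (f + g), b)"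
  by (simp add: lamplighter_mult poly_seq_def mod_simps fun_eq_iff)

lemma poly_seq_mult_zero:
  "(poly_seq p f, b) \<otimes>\<^bsub>lamplighter p\<^esub> (\<lambda>_. 0, b') = (poly_seq p f, b + b')"
  by (simp add: lamplighter_mult poly_seq_def fun_eq_iff)

text \<open>Under the convention that b sends a_i to a_(b+i), translation by -1 moves lamps one
  place to the right, that is, multiplies by X. This is one Horner step.\<close>

lemma poly_seq_pCons:
  "(poly_seq p [:c:], - 1) \<otimes>\<^bsub>lamplighter p\<^esub> (poly_seq p f, b) = (poly_seq p (pCons c f), b - 1)"
proof -
  have "(poly_seq p [:c:] i + poly_seq p f (i - 1)) mod int p = poly_seq p (pCons c f) i" for i
  proof (cases "i \<le> 0")
    case False
    then have "nat i = Suc (nat (i - 1))" by simp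
    then show ?thesis using False by (simp add: poly_seq_def)
  qed (auto simp: poly_seq_def)
  then show ?thesis by (simp add: lamplighter_mult)
qed

section \<open>Normal subgroups of the lamplighter group\<close>

definition trace_ideal :: "nat \<Rightarrow> ((int \<Rightarrow> int) \<times> int) set \<Rightarrow> int poly set"
  where "trace_ideal p N = {f. (poly_seq p f, 0) \<in> N}"

text \<open>Products in the base group add polynomials, and conjugation by the translation -1
  multiplies by X. Closure of \<open>N\<close> under both gives closure under multiplication by any
  polynomial.\<close>

lemma trace_ideal:
  assumes p: "p > 0" and N: "N \<lhd> lamplighter p"
  shows "is_ideal (trace_ideal p N)" "of_nat p \<in> trace_ideal p N"
proof -
  interpret group "lamplighter p" by (rule group_lamplighter)
  interpret N: normal N "lamplighter p" by (rule N)
  have zero: "0 \<in> trace_ideal p N"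
    using N.one_closed by (simp add: trace_ideal_def poly_seq_0 lamplighter_one)
  have add: "f + g \<in> trace_ideal p N" if "f \<in> trace_ideal p N" "g \<in> trace_ideal p N" for f g
    using that N.m_closed poly_seq_add[of p f g 0] by (fastforce simp: trace_ideal_def)
  have uminus: "- f \<in> trace_ideal p N" if "f \<in> trace_ideal p N" for f
  proof -
    have "inv\<^bsub>lamplighter p\<^esub> (poly_seq p f, 0) = (poly_seq p (- f), 0)"
      unfolding lamplighter_inv[OF p poly_seq_carrier[OF p]]
      by (simp add: poly_seq_def mod_simps fun_eq_iff)
    then show ?thesis using that N.m_inv_closed[of "(poly_seq p f, 0)"] by (simp add: trace_ideal_def)
  qed
  have smult: "smult c f \<in> trace_ideal p N" if f: "f \<in> trace_ideal p N" for c f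
  proof (induction c rule: int_induct[of _ 0])
    case base
    then show ?case using zero by simp
  next
    case (step1 c)
    then show ?case using add[OF step1(2) f] by (simp add: smult_add_left)
  next
    case (step2 c)
    then show ?case using add[OF step2(2) uminus[OF f]] by (simp add: smult_diff_left)
  qed
  have shift: "pCons 0 f \<in> trace_ideal p N" if "f \<in> trace_ideal p N" for f
  proof -
    let ?x = "(\<lambda>_. 0, - 1) :: (int \<Rightarrow> int) \<times> int"
    have x: "?x \<in> carrier (lamplighter p)" using p by (simp add: lamplighter_carrier)
    have "?x \<otimes>\<^bsub>lamplighter p\<^esub> (poly_seq p f, 0) \<otimes>\<^bsub>lamplighter p\<^esub> inv\<^bsub>lamplighter p\<^esub> ?x \<in> N"
      using that x by (intro N.inv_op_closed2) (auto simp: trace_ideal_def)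
    moreover have "?x \<otimes>\<^bsub>lamplighter p\<^esub> (poly_seq p f, 0) = (poly_seq p (pCons 0 f), - 1)"
      using poly_seq_pCons[of p 0 f 0] by (simp add: poly_seq_0)
    moreover have "inv\<^bsub>lamplighter p\<^esub> ?x = (\<lambda>_. 0, 1)"
      unfolding lamplighter_inv[OF p x] by simp
    ultimately show ?thesis by (simp add: poly_seq_mult_zero trace_ideal_def)
  qed
  have "r * f \<in> trace_ideal p N" if "f \<in> trace_ideal p N" for r f
  proof (induction r)
    case 0
    then show ?case using zero by simp
  next
    case (pCons c r)
    then show ?case using add[OF smult[OF that] shift] by simp
  qed
  then show "is_ideal (trace_ideal p N)" using zero add by (auto simp: is_ideal_def)
  have "poly_seq p (of_nat p) = (\<lambda>_. 0)"
    by (auto simp: poly_seq_def of_nat_poly coeff_pCons split: nat.splits)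
  then show "of_nat p \<in> trace_ideal p N"
    using N.one_closed by (simp add: trace_ideal_def lamplighter_one)
qed

text \<open>The commutator of (c, m) with the configuration X^m is 1 - X^m, because the translation
  by m moves the lamp from m to 0 and the base group is abelian. Starting at X^m keeps both lamps at
  nonnegative positions.\<close>

lemma trace_ideal_root:
  assumes p: "p > 0" and N: "N \<lhd> lamplighter p" and c: "(c, int m) \<in> N"
  shows "poly_X ^ m - 1 \<in> trace_ideal p N"
proof -
  interpret group "lamplighter p" by (rule group_lamplighter)
  interpret N: normal N "lamplighter p" by (rule N)
  let ?g = "(c, int m)" and ?h = "(poly_seq p (poly_X ^ m), 0)" and ?k = "(poly_seq p (1 - poly_X ^ m), 0)"
  have gc: "?g \<in> carrier (lamplighter p)" using c N.subset by blast
  have hc: "?h \<in> carrier (lamplighter p)" and kc: "?k \<in> carrier (lamplighter p)"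
    using poly_seq_carrier[OF p] by auto
  have "poly_seq p (poly_X ^ m) (int m + i) = poly_seq p 1 i" for i
    by (cases "i = 0") (auto simp: poly_seq_def poly_X_power nat_eq_iff)
  then have "?g \<otimes>\<^bsub>lamplighter p\<^esub> ?h = (poly_seq p 1, 0) \<otimes>\<^bsub>lamplighter p\<^esub> ?g"
    by (simp add: lamplighter_mult add.commute)
  also have "\<dots> = ?k \<otimes>\<^bsub>lamplighter p\<^esub> ?h \<otimes>\<^bsub>lamplighter p\<^esub> ?g"
    by (simp add: poly_seq_add)
  finally have "?k = ?g \<otimes>\<^bsub>lamplighter p\<^esub> ?h \<otimes>\<^bsub>lamplighter p\<^esub>
      inv\<^bsub>lamplighter p\<^esub> (?h \<otimes>\<^bsub>lamplighter p\<^esub> ?g)"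
    using gc hc kc by (simp add: m_assoc inv_solve_right)
  also have "\<dots> = ?g \<otimes>\<^bsub>lamplighter p\<^esub> (?h \<otimes>\<^bsub>lamplighter p\<^esub> inv\<^bsub>lamplighter p\<^esub> ?g
      \<otimes>\<^bsub>lamplighter p\<^esub> inv\<^bsub>lamplighter p\<^esub> ?h)"
    using gc hc by (simp add: m_assoc inv_mult_group)
  also have "\<dots> \<in> N"
    using c gc hc by (intro N.m_closed N.inv_op_closed2 N.m_inv_closed)
  finally have "1 - poly_X ^ m \<in> trace_ideal p N" by (simp add: trace_ideal_def)
  then show ?thesis by (rule ideal_cong_sym[OF trace_ideal(1)[OF p N]])
qed

text \<open>Take m to be the least positive translation occurring in \<open>N\<close>. Pairs of a
  polynomial from \<open>S\<close> and a translation below m lie in distinct cosets: equal cosets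
  force equal translations by minimality, and then congruent polynomials.\<close>

lemma index_ge:
  assumes p: "p > 0" and N: "N \<lhd> lamplighter p" and fin: "finite (rcosets\<^bsub>lamplighter p\<^esub> N)"
  obtains m where "m > 0" "poly_X ^ m - 1 \<in> trace_ideal p N"
    "\<And>S. finite S \<Longrightarrow> incongruent (trace_ideal p N) S \<Longrightarrow> m * card S \<le> card (rcosets\<^bsub>lamplighter p\<^esub> N)"
proof -
  interpret group "lamplighter p" by (rule group_lamplighter)
  interpret N: normal N "lamplighter p" by (rule N)
  have sub: "subgroup N (lamplighter p)" by (rule N.subgroup_axioms)
  let ?L = "lamplighter p"
  have quot: "(\<lambda>i. (poly_seq p f i - poly_seq p g (i + (b - b'))) mod int p, b - b') \<in> N"
    if "N #>\<^bsub>?L\<^esub> (poly_seq p f, b) = N #>\<^bsub>?L\<^esub> (poly_seq p g, b')" for f g b b'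
  proof -
    have c: "(poly_seq p f, b) \<in> carrier ?L" "(poly_seq p g, b') \<in> carrier ?L"
      using poly_seq_carrier[OF p] by auto
    have "(poly_seq p f, b) \<in> N #>\<^bsub>?L\<^esub> (poly_seq p g, b')"
      using that rcos_self[OF c(1) sub] by simp
    then have "(poly_seq p f, b) \<otimes>\<^bsub>?L\<^esub> inv\<^bsub>?L\<^esub> (poly_seq p g, b') \<in> N"
      using N.rcos_module_imp[OF is_group c(2)] by blast
    then show ?thesis
      unfolding lamplighter_inv[OF p c(2)] by (simp add: lamplighter_mult mod_simps algebra_simps)
  qed
  have coset: "N #>\<^bsub>?L\<^esub> (poly_seq p f, b) \<in> rcosets\<^bsub>?L\<^esub> N" for f b
    using rcosetsI[OF N.subset poly_seq_carrier[OF p]] .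
  \<comment> \<open>Infinitely many translations fall into finitely many cosets, so two of them
    agree.\<close>
  have "\<exists>m>0. \<exists>c. (c, int m) \<in> N"
  proof -
    let ?f = "\<lambda>b::nat. N #>\<^bsub>?L\<^esub> (poly_seq p 0, int b)"
    have "\<not> inj_on ?f UNIV"
    proof
      assume "inj_on ?f UNIV"
      moreover have "finite (range ?f)" using coset by (intro finite_subset[OF _ fin]) blast
      ultimately show False using finite_imageD infinite_UNIV_nat by blast
    qed
    then obtain i j where "?f i = ?f j" "i < j" using linorder_injI[of ?f] by blast
    then show ?thesis
      using quot[of 0 "int j" 0 "int i"] by (intro exI[of _ "j - i"]) (auto simp: of_nat_diff)
  qed
  then have ex: "\<exists>m. m > 0 \<and> (\<exists>c. (c, int m) \<in> N)" by blast
  define m where "m = (LEAST m. m > 0 \<and> (\<exists>c. (c, int m) \<in> N))"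
  have m: "m > 0" "\<exists>c. (c, int m) \<in> N" using LeastI_ex[OF ex] by (auto simp: m_def)
  have least: "(c, int j) \<notin> N" if "0 < j" "j < m" for c j
    using not_less_Least[of j "\<lambda>m. m > 0 \<and> (\<exists>c. (c, int m) \<in> N)"] that by (auto simp: m_def)
  have "m * card S \<le> card (rcosets\<^bsub>?L\<^esub> N)" if S: "finite S" "incongruent (trace_ideal p N) S" for S
  proof -
    let ?f = "\<lambda>(s, b). N #>\<^bsub>?L\<^esub> (poly_seq p s, int b)"
    have le: "b \<le> b'" if eq: "?f (s, b) = ?f (s', b')" and "b < m" "b' < m" for s s' b b'
    proof (rule ccontr)
      assume "\<not> b \<le> b'"
      then show False
        using quot[of s "int b" s' "int b'"] eq least[of "b - b'"] that(2) by (auto simp: of_nat_diff)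
    qed
    have "inj_on ?f (S \<times> {..<m})"
    proof (rule inj_onI; clarify)
      fix s b s' b' assume *: "s \<in> S" "s' \<in> S" "b < m" "b' < m"
        "N #>\<^bsub>?L\<^esub> (poly_seq p s, int b) = N #>\<^bsub>?L\<^esub> (poly_seq p s', int b')"
      then have b: "b = b'" using le[of s b s' b'] le[of s' b' s b] by simp
      have "(\<lambda>i. (poly_seq p s i - poly_seq p s' i) mod int p) = poly_seq p (s - s')"
        by (simp add: poly_seq_def mod_simps fun_eq_iff)
      then have "s - s' \<in> trace_ideal p N"
        using quot[OF *(5)] b by (simp add: trace_ideal_def)
      then show "s = s' \<and> b = b'" using S(2) * b by (simp add: incongruent_def)
    qed
    then have "card (?f ` (S \<times> {..<m})) = m * card S"
      by (simp add: card_image card_cartesian_product)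
    moreover have "card (?f ` (S \<times> {..<m})) \<le> card (rcosets\<^bsub>?L\<^esub> N)"
      using coset by (intro card_mono[OF fin]) auto
    ultimately show ?thesis by simp
  qed
  then show thesis using that m trace_ideal_root[OF p N] by blast
qed

lemma index_avoiding_witness:
  assumes p: "prime p" and N: "N \<lhd> lamplighter p" and fin: "finite (rcosets\<^bsub>lamplighter p\<^esub> N)"
    and w: "(poly_seq p (witness_poly p R d), 0) \<notin> N"
  shows "Suc R * p ^ Suc d \<le> card (rcosets\<^bsub>lamplighter p\<^esub> N)"
proof -
  have p0: "p > 0" using prime_gt_0_nat[OF p] .
  note I = trace_ideal[OF p0 N]
  have w: "witness_poly p R d \<notin> trace_ideal p N" using w by (simp add: trace_ideal_def)
  obtain m where m: "m > 0" "poly_X ^ m - 1 \<in> trace_ideal p N"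
    "\<And>S. finite S \<Longrightarrow> incongruent (trace_ideal p N) S \<Longrightarrow> m * card S \<le> card (rcosets\<^bsub>lamplighter p\<^esub> N)"
    using index_ge[OF p0 N fin] by blast
  have "m > R" using witness_poly_mem_of_root[OF I(1) m(2), of R p d] w m(1) by force
  moreover obtain S where S: "finite S" "incongruent (trace_ideal p N) S" "card S \<ge> p ^ Suc d"
    using witness_poly_mem_of_index[OF p I, of d R] w not_le by blast
  ultimately have "Suc R * p ^ Suc d \<le> m * card S" by (intro mult_le_mono) auto
  also have "\<dots> \<le> card (rcosets\<^bsub>lamplighter p\<^esub> N)" using S by (intro m(3))
  finally show ?thesis .
qed

section \<open>Finite quotients of the lamplighter group obtained from ideals\<close>

definition cyclic_eval :: "nat \<Rightarrow> (int \<Rightarrow> int) \<Rightarrow> int poly"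
  where "cyclic_eval m a = (\<Sum>i | a i \<noteq> 0. of_int (a i) * poly_X ^ nat (i mod int m))"

lemma cyclic_eval_eq:
  assumes "finite F" "{i. a i \<noteq> 0} \<subseteq> F"
  shows "cyclic_eval m a = (\<Sum>i\<in>F. of_int (a i) * poly_X ^ nat (i mod int m))"
  unfolding cyclic_eval_def using assms by (intro sum.mono_neutral_left) auto

lemma power_cong_mod:
  assumes J: "is_ideal J" "poly_X ^ m - 1 \<in> J" and "k mod m = l mod m"
  shows "poly_X ^ k - poly_X ^ l \<in> J"
proof -
  have "poly_X ^ k - poly_X ^ (k mod m) \<in> J" for k
  proof -
    have "(poly_X ^ m) ^ (k div m) * poly_X ^ (k mod m) - 1 ^ (k div m) * poly_X ^ (k mod m) \<in> J"
      using is_ideal_zero[OF J(1)] by (intro ideal_cong_mult[OF J(1)] ideal_cong_power J) simp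
    then show ?thesis by (simp flip: power_mult power_add)
  qed
  then show ?thesis using ideal_cong_trans[OF J(1)] ideal_cong_sym[OF J(1)] assms(3) by metis
qed

text \<open>\<open>cyclic_eval\<close> reads a configuration as a Laurent polynomial with exponents
  reduced modulo m, which is harmless when X^m = 1 modulo \<open>J\<close>. Shifting indices by b
  multiplies that Laurent polynomial by X^(-b).\<close>

lemma cyclic_eval_mult:
  assumes J: "is_ideal J" "of_nat p \<in> J" "poly_X ^ m - 1 \<in> J" and m: "m > 0"
    and fin: "finite {i. a i \<noteq> 0}" "finite {i. a' i \<noteq> 0}"
  shows "cyclic_eval m (\<lambda>i. (a i + a' (b + i)) mod int p)
      - (cyclic_eval m a + poly_X ^ nat ((- b) mod int m) * cyclic_eval m a') \<in> J"
proof -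
  let ?t = "\<lambda>i. poly_X ^ nat (i mod int m)"
  let ?s = "\<lambda>i. (a i + a' (b + i)) mod int p"
  define F where "F = {i. a i \<noteq> 0} \<union> (\<lambda>i. i - b) ` {i. a' i \<noteq> 0}"
  have F: "finite F" using fin by (simp add: F_def)
  have aF: "a i = 0" and a'F: "a' (b + i) = 0" if "i \<notin> F" for i
    using that by (auto simp: F_def image_iff)
  have s: "cyclic_eval m ?s = (\<Sum>i\<in>F. of_int (?s i) * ?t i)"
  proof (rule cyclic_eval_eq[OF F], rule subsetI)
    fix i assume "i \<in> {i. ?s i \<noteq> 0}"
    then show "i \<in> F" using aF[of i] a'F[of i] by (cases "i \<in> F") auto
  qed
  have a: "cyclic_eval m a = (\<Sum>i\<in>F. of_int (a i) * ?t i)"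
    using aF by (intro cyclic_eval_eq[OF F]) blast
  have "cyclic_eval m a' = (\<Sum>i\<in>(\<lambda>i. b + i) ` F. of_int (a' i) * ?t i)"
  proof (intro cyclic_eval_eq)
    show "{i. a' i \<noteq> 0} \<subseteq> (\<lambda>i. b + i) ` F"
      using a'F by (auto simp: image_iff) (metis diff_add_cancel add.commute)
  qed (use F in simp)
  also have "\<dots> = (\<Sum>i\<in>F. of_int (a' (b + i)) * ?t (b + i))"
    by (subst sum.reindex) (auto simp: inj_on_def)
  finally have a': "cyclic_eval m a' = (\<Sum>i\<in>F. of_int (a' (b + i)) * ?t (b + i))" .
  have "of_int (?s i) * ?t i - (of_int (a i) * ?t i + ?t (- b) * (of_int (a' (b + i)) * ?t (b + i))) \<in> J" for i
  proof -
    have "of_int (?s i) = of_int (a i + a' (b + i)) - of_int ((a i + a' (b + i)) div int p) * (of_nat p :: int poly)"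
      by (metis minus_div_mult_eq_mod of_int_diff of_int_mult of_int_of_nat_eq)
    then have 1: "of_int (?s i) - (of_int (a i + a' (b + i)) :: int poly) \<in> J"
      using is_ideal_uminus[OF J(1) is_ideal_mult[OF J(1,2)]] by simp
    have "int ((nat ((- b) mod int m) + nat ((b + i) mod int m)) mod m) = int (nat (i mod int m) mod m)"
      using m by (simp add: zmod_int mod_simps)
    then have "poly_X ^ nat (i mod int m) - poly_X ^ (nat ((- b) mod int m) + nat ((b + i) mod int m)) \<in> J"
      by (intro power_cong_mod[OF J(1,3)]) simp
    then have 2: "?t i - ?t (- b) * ?t (b + i) \<in> J" by (simp add: power_add)
    have "of_int (?s i) * ?t i - of_int (a i + a' (b + i)) * ?t i \<in> J"
      using 1 is_ideal_zero[OF J(1)] by (intro ideal_cong_mult[OF J(1)]) simp_all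
    moreover have "of_int (a' (b + i)) * (?t i - ?t (- b) * ?t (b + i)) \<in> J"
      using 2 by (rule is_ideal_mult[OF J(1)])
    ultimately have "of_int (?s i) * ?t i - of_int (a i + a' (b + i)) * ?t i
      + of_int (a' (b + i)) * (?t i - ?t (- b) * ?t (b + i)) \<in> J" by (rule is_ideal_add[OF J(1)])
    then show ?thesis by (simp add: algebra_simps)
  qed
  then show ?thesis
    unfolding s a a' sum_distrib_left
    by (simp only: sum.distrib[symmetric] sum_subtractf[symmetric]) (intro is_ideal_sum[OF J(1)])
qed

definition residue_class :: "int poly set \<Rightarrow> int poly \<Rightarrow> int poly set"
  where "residue_class J x = {y. x - y \<in> J}"

lemma residue_class_eq:
  assumes "is_ideal J"
  shows "residue_class J x = residue_class J y \<longleftrightarrow> x - y \<in> J"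
proof
  assume "residue_class J x = residue_class J y"
  moreover have "y \<in> residue_class J y" using is_ideal_zero[OF assms] by (simp add: residue_class_def)
  ultimately show "x - y \<in> J" by (auto simp: residue_class_def)
next
  assume "x - y \<in> J"
  then show "residue_class J x = residue_class J y"
    unfolding residue_class_def using ideal_cong_trans[OF assms] ideal_cong_sym[OF assms] by blast
qed

text \<open>The quotient is the semidirect product of Z[X]/J with Z/m, where the action factors
  through Z/m because X^m = 1 modulo \<open>J\<close>. Its order is at most q * m, and (a, b)
  survives if either of its coordinates does.\<close>

lemma quotient_of_ideal:
  assumes p: "p > 0" and J: "is_ideal J" "of_nat p \<in> J" "poly_X ^ m - 1 \<in> J" and m: "m > 0"
    and Q: "finite Q" "card Q \<le> q" "\<And>x. \<exists>r\<in>Q. x - r \<in> J"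
    and g: "cyclic_eval m a \<notin> J \<or> \<not> int m dvd b"
  shows "\<exists>N. N \<lhd> lamplighter p \<and> finite (rcosets\<^bsub>lamplighter p\<^esub> N) \<and> (a, b) \<notin> N
    \<and> card (rcosets\<^bsub>lamplighter p\<^esub> N) \<le> q * m"
proof -
  interpret group "lamplighter p" by (rule group_lamplighter)
  define c where "c = (\<lambda>(a, b). (residue_class J (cyclic_eval m a), b mod int m))"
  have cong: "c (x \<otimes>\<^bsub>lamplighter p\<^esub> y) = c (x' \<otimes>\<^bsub>lamplighter p\<^esub> y')"
    if car: "x \<in> carrier (lamplighter p)" "x' \<in> carrier (lamplighter p)"
      "y \<in> carrier (lamplighter p)" "y' \<in> carrier (lamplighter p)"
      and eq: "c x = c x'" "c y = c y'" for x x' y y'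
  proof -
    obtain a1 b1 a1' b1' a2 b2 a2' b2' where
      xy: "x = (a1, b1)" "x' = (a1', b1')" "y = (a2, b2)" "y' = (a2', b2')"
      by (cases x, cases x', cases y, cases y')
    have fin: "finite {i. a1 i \<noteq> 0}" "finite {i. a1' i \<noteq> 0}" "finite {i. a2 i \<noteq> 0}" "finite {i. a2' i \<noteq> 0}"
      using car p by (auto simp: xy lamplighter_carrier)
    have b: "b1 mod int m = b1' mod int m" "b2 mod int m = b2' mod int m"
      and e: "cyclic_eval m a1 - cyclic_eval m a1' \<in> J" "cyclic_eval m a2 - cyclic_eval m a2' \<in> J"
      using eq by (simp_all add: xy c_def residue_class_eq[OF J(1)])
    have nb: "(- b1) mod int m = (- b1') mod int m" using b(1) by (metis mod_minus_eq)
    have "(b1 + b2) mod int m = (b1' + b2') mod int m" using b by (metis mod_add_eq)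
    moreover have "cyclic_eval m (\<lambda>i. (a1 i + a2 (b1 + i)) mod int p)
        - cyclic_eval m (\<lambda>i. (a1' i + a2' (b1' + i)) mod int p) \<in> J"
    proof (rule ideal_cong_trans[OF J(1) cyclic_eval_mult[OF J m fin(1,3)]])
      show "(cyclic_eval m a1 + poly_X ^ nat ((- b1) mod int m) * cyclic_eval m a2)
          - cyclic_eval m (\<lambda>i. (a1' i + a2' (b1' + i)) mod int p) \<in> J"
      proof (rule ideal_cong_trans[OF J(1) _ ideal_cong_sym[OF J(1) cyclic_eval_mult[OF J m fin(2,4)]]])
        show "(cyclic_eval m a1 + poly_X ^ nat ((- b1) mod int m) * cyclic_eval m a2)
          - (cyclic_eval m a1' + poly_X ^ nat ((- b1') mod int m) * cyclic_eval m a2') \<in> J"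
          unfolding nb using e is_ideal_zero[OF J(1)]
          by (intro ideal_cong_add[OF J(1)] ideal_cong_mult[OF J(1)]) simp_all
      qed
    qed
    ultimately show ?thesis by (simp add: xy c_def lamplighter_mult residue_class_eq[OF J(1)])
  qed
  have sub: "c ` carrier (lamplighter p) \<subseteq> (residue_class J ` Q) \<times> {0..<int m}"
  proof (rule subsetI, elim imageE)
    fix k x assume k: "k = c x"
    obtain a b where x: "x = (a, b)" by (cases x)
    have "fst (c (a, b)) \<in> residue_class J ` Q \<and> snd (c (a, b)) \<in> {0..<int m}"
    proof
      obtain r where "r \<in> Q" "cyclic_eval m a - r \<in> J" using Q(3) by blast
      then show "fst (c (a, b)) \<in> residue_class J ` Q"
        using residue_class_eq[OF J(1)] by (auto simp: c_def)
      show "snd (c (a, b)) \<in> {0..<int m}" using m by (simp add: c_def)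
    qed
    then show "k \<in> (residue_class J ` Q) \<times> {0..<int m}" by (simp only: mem_Times_iff k x)
  qed
  have fin: "finite (c ` carrier (lamplighter p))" using Q(1) by (intro finite_subset[OF sub]) simp
  note ker = congruence_kernel[of c, OF cong fin]
  have "card (c ` carrier (lamplighter p)) \<le> card ((residue_class J ` Q) \<times> {0..<int m})"
    using Q(1) by (intro card_mono[OF _ sub]) simp
  also have "\<dots> \<le> q * m"
    using card_image_le[OF Q(1), of "residue_class J"] Q(2) by (simp add: card_cartesian_product)
  finally have "card (c ` carrier (lamplighter p)) \<le> q * m" .
  with ker(3) have "card (rcosets\<^bsub>lamplighter p\<^esub> {g \<in> carrier (lamplighter p). c g = c \<one>\<^bsub>lamplighter p\<^esub>}) \<le> q * m"
    by (rule order_trans)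
  moreover have "c (a, b) \<noteq> c \<one>\<^bsub>lamplighter p\<^esub>"
    using g by (auto simp: c_def lamplighter_one residue_class_eq[OF J(1)] cyclic_eval_def dvd_eq_mod_eq_0)
  ultimately show ?thesis using ker(1,2) by blast
qed

lemma exists_small_quotient:
  assumes p: "prime p" and g: "(a, b) \<in> carrier (lamplighter p)" "(a, b) \<noteq> \<one>\<^bsub>lamplighter p\<^esub>"
    and bd: "\<bar>b\<bar> \<le> int n" "\<And>i. a i \<noteq> 0 \<Longrightarrow> \<bar>i\<bar> \<le> int n"
  shows "\<exists>N. N \<lhd> lamplighter p \<and> finite (rcosets\<^bsub>lamplighter p\<^esub> N) \<and> (a, b) \<notin> N
    \<and> card (rcosets\<^bsub>lamplighter p\<^esub> N) \<le> (p * (2 * n + 2)) ^ 2"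
proof -
  have p0: "p > 0" and p2: "p \<ge> 2" using prime_gt_0_nat[OF p] prime_ge_2_nat[OF p] by auto
  show ?thesis
  proof (cases "b = 0")
    case False
    \<comment> \<open>The modulus |b| + 1 cannot divide the nonzero b. With \<open>J\<close> the
      whole ring, only the cyclic quotient Z/m remains.\<close>
    define m where "m = Suc (nat \<bar>b\<bar>)"
    have "\<not> int m dvd b" using False zdvd_imp_le[of "int m" "\<bar>b\<bar>"] by (auto simp: m_def)
    then obtain N where N: "N \<lhd> lamplighter p" "finite (rcosets\<^bsub>lamplighter p\<^esub> N)" "(a, b) \<notin> N"
      "card (rcosets\<^bsub>lamplighter p\<^esub> N) \<le> 1 * m"
      using quotient_of_ideal[OF p0, of UNIV m "{0}" 1 a b] by (auto simp: is_ideal_def m_def)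
    note N(4)
    also have "1 * m \<le> 1 * (2 * n + 2)" using bd(1) by (simp add: m_def)
    also have "\<dots> \<le> p * (2 * n + 2)" using p0 by (intro mult_le_mono1) simp
    also have "\<dots> \<le> (p * (2 * n + 2)) ^ 2" by (rule self_le_power) (use p0 in auto)
    finally show ?thesis using N by blast
  next
    case True
    obtain e where e: "p ^ e \<le> 2 * n + 2" "2 * n + 2 < p ^ (e + 1)"
      using ex_power_ivl1[of p "2 * n + 2"] p2 by auto
    \<comment> \<open>This is the order of the unit group of a field with p^(e+1) elements. It
      exceeds 2n + 1, so the positions in [-n, n] stay distinct modulo m and no two lamps of
      \<open>a\<close> are merged.\<close>
    define m where "m = p ^ Suc e - 1"
    have m: "2 * n + 1 < m" "m > 0" using e(2) by (auto simp: m_def)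
    have car: "\<And>i. a i \<in> {0..<int p}" "finite {i. a i \<noteq> 0}" using g(1) p0 by (auto simp: lamplighter_carrier)
    obtain i where i: "a i \<noteq> 0" using g(2) True by (auto simp: lamplighter_one)
    have inj: "i = j" if "a i \<noteq> 0" "a j \<noteq> 0" "i mod int m = j mod int m" for i j
    proof -
      have "int m dvd i - j" using that(3) by (simp add: mod_eq_dvd_iff)
      moreover have "\<bar>i - j\<bar> < int m" using bd(2)[OF that(1)] bd(2)[OF that(2)] m(1) by linarith
      ultimately show ?thesis using zdvd_imp_le[of "int m" "\<bar>i - j\<bar>"] by (cases "i = j") auto
    qed
    have "coeff (cyclic_eval m a) (nat (i mod int m))
      = (\<Sum>j | a j \<noteq> 0. a j * (if nat (j mod int m) = nat (i mod int m) then 1 else 0))"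
      unfolding cyclic_eval_def coeff_sum
      by (intro sum.cong) (auto simp: poly_X_power of_int_poly)
    also have "\<dots> = (\<Sum>j\<in>{i}. a j * (if nat (j mod int m) = nat (i mod int m) then 1 else 0))"
    proof (intro sum.mono_neutral_right ballI)
      fix j assume j: "j \<in> {j. a j \<noteq> 0} - {i}"
      then have "j mod int m \<noteq> i mod int m" using inj[of j i] i by blast
      moreover have "j mod int m \<ge> 0" "i mod int m \<ge> 0" using m(2) by simp_all
      ultimately have "nat (j mod int m) \<noteq> nat (i mod int m)" by linarith
      then show "a j * (if nat (j mod int m) = nat (i mod int m) then 1 else 0) = 0" by simp
    qed (use car(2) i in auto)
    finally have "coeff (cyclic_eval m a) (nat (i mod int m)) = a i" by simp
    moreover have "\<not> int p dvd a i" using car(1)[of i] i zdvd_imp_le[of "int p" "a i"] by force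
    ultimately have nd: "\<not> int p dvd coeff (cyclic_eval m a) (nat (i mod int m))" by simp
    have deg: "degree (cyclic_eval m a) < m"
    proof (rule degree_lessI)
      show "\<forall>k\<ge>m. coeff (cyclic_eval m a) k = 0"
      proof (intro allI impI)
        fix k assume k: "k \<ge> m"
        have "nat (j mod int m) \<noteq> k" for j
          using k m(2) pos_mod_bound[of "int m" j] pos_mod_sign[of "int m" j] by linarith
        then show "coeff (cyclic_eval m a) k = 0"
          unfolding cyclic_eval_def coeff_sum by (intro sum.neutral) (auto simp: poly_X_power of_int_poly)
      qed
    qed (use m in simp)
    obtain J where J: "is_ideal J" "of_nat p \<in> J" "poly_X ^ m - 1 \<in> J" "cyclic_eval m a \<notin> J"
      "\<exists>Q. finite Q \<and> card Q \<le> p ^ Suc e \<and> (\<forall>x. \<exists>r\<in>Q. x - r \<in> J)"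
      using separating_ideal[OF p _ m_def deg nd] by blast
    then obtain Q where Q: "finite Q" "card Q \<le> p ^ Suc e" "\<And>x. \<exists>r\<in>Q. x - r \<in> J" by blast
    obtain N where N: "N \<lhd> lamplighter p" "finite (rcosets\<^bsub>lamplighter p\<^esub> N)" "(a, b) \<notin> N"
      "card (rcosets\<^bsub>lamplighter p\<^esub> N) \<le> p ^ Suc e * m"
      using quotient_of_ideal[OF p0 J(1-3) m(2) Q, of a b] J(4) by blast
    have "p ^ Suc e \<le> p * (2 * n + 2)" using mult_le_mono2[OF e(1), of p] by (simp only: power_Suc)
    moreover have "m \<le> p ^ Suc e" by (simp add: m_def)
    ultimately have "p ^ Suc e * m \<le> (p * (2 * n + 2)) ^ 2"
      unfolding power2_eq_square by (intro mult_le_mono) auto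
    then show ?thesis using N by fastforce
  qed
qed

section \<open>Word length compared with support and degree\<close>

lemma word_support_bound:
  assumes p: "p > 0" and X: "X \<subseteq> carrier (lamplighter p)"
    and K: "\<And>a b. (a, b) \<in> X \<union> m_inv (lamplighter p) ` X \<Longrightarrow>
      \<bar>b\<bar> \<le> int K \<and> (\<forall>i. a i \<noteq> 0 \<longrightarrow> \<bar>i\<bar> \<le> int K)"
    and g: "word_within (lamplighter p) X k (a, b)"
  shows "\<bar>b\<bar> \<le> int (k * K) \<and> (\<forall>i. a i \<noteq> 0 \<longrightarrow> \<bar>i\<bar> \<le> int (k * K))"
proof -
  obtain w where w: "set w \<subseteq> X \<union> m_inv (lamplighter p) ` X" "length w \<le> k"
    "foldr (monoid.mult (lamplighter p)) w \<one>\<^bsub>lamplighter p\<^esub> = (a, b)"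
    using g by (auto simp: word_within_def)
  have "\<bar>b\<bar> \<le> int (length w * K) \<and> (\<forall>i. a i \<noteq> 0 \<longrightarrow> \<bar>i\<bar> \<le> int (length w * K))"
    using w(1,3)
  proof (induction w arbitrary: a b)
    case Nil
    then show ?case by (auto simp: lamplighter_one)
  next
    case (Cons x w)
    obtain a1 b1 where x: "x = (a1, b1)" by (cases x)
    obtain a2 b2 where y: "foldr (monoid.mult (lamplighter p)) w \<one>\<^bsub>lamplighter p\<^esub> = (a2, b2)"
      by (cases "foldr (monoid.mult (lamplighter p)) w \<one>\<^bsub>lamplighter p\<^esub>")
    have 1: "\<bar>b1\<bar> \<le> int K" "\<And>i. a1 i \<noteq> 0 \<Longrightarrow> \<bar>i\<bar> \<le> int K" using K[of a1 b1] Cons.prems x by auto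
    have 2: "\<bar>b2\<bar> \<le> int (length w * K)" "\<And>i. a2 i \<noteq> 0 \<Longrightarrow> \<bar>i\<bar> \<le> int (length w * K)"
      using Cons.IH[OF _ y] Cons.prems by auto
    have ab: "a = (\<lambda>i. (a1 i + a2 (b1 + i)) mod int p)" "b = b1 + b2"
      using Cons.prems(2) x y by (auto simp: lamplighter_mult)
    have "\<bar>i\<bar> \<le> int K + int (length w * K)" if "a i \<noteq> 0" for i
    proof -
      \<comment> \<open>The first letter adds lamps within distance K and displaces the support of
        the remaining word by at most K.\<close>
      have "a1 i \<noteq> 0 \<or> a2 (b1 + i) \<noteq> 0" using that ab by auto
      then show ?thesis using 1 2 by force
    qed
    then show ?case using 1 2 ab by auto
  qed
  moreover have "int (length w * K) \<le> int (k * K)" using w(2) by (simp only: of_nat_le_iff mult_le_mono1)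
  ultimately show ?thesis by fastforce
qed

lemma support_bound_exists:
  assumes "p > 0" "finite X" "X \<subseteq> carrier (lamplighter p)"
  shows "\<exists>K. \<forall>(a, b)\<in>X. \<bar>b\<bar> \<le> int K \<and> (\<forall>i. a i \<noteq> 0 \<longrightarrow> \<bar>i\<bar> \<le> int K)"
  using assms(2,3)
proof (induction X rule: finite_induct)
  case empty
  then show ?case by simp
next
  case (insert x X)
  then obtain K where K: "\<forall>(a, b)\<in>X. \<bar>b\<bar> \<le> int K \<and> (\<forall>i. a i \<noteq> 0 \<longrightarrow> \<bar>i\<bar> \<le> int K)" by auto
  obtain a b where x: "x = (a, b)" by (cases x)
  have fin: "finite {i. a i \<noteq> 0}" using insert.prems assms(1) by (simp add: x lamplighter_carrier)
  define K' where "K' = K + nat \<bar>b\<bar> + (\<Sum>i | a i \<noteq> 0. nat \<bar>i\<bar>)"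
  have "\<bar>i\<bar> \<le> int K'" if "a i \<noteq> 0" for i
  proof -
    have "nat \<bar>i\<bar> \<le> (\<Sum>i | a i \<noteq> 0. nat \<bar>i\<bar>)"
      using fin that by (intro member_le_sum) auto
    then have "nat \<bar>i\<bar> \<le> K'" unfolding K'_def by linarith
    then show ?thesis by linarith
  qed
  moreover have "\<bar>b\<bar> \<le> int K'" "K \<le> K'" by (auto simp: K'_def)
  ultimately show ?case using K x by (intro exI[of _ K']) fastforce
qed

text \<open>Horner's scheme: one letter of \<open>E\<close> per coefficient sets a lamp and
  translates by -1, and n unit translations then lead back. Each letter of \<open>E\<close> costs at
  most k generators, so the length is linear in the degree bound.\<close>

lemma word_within_poly_seq:
  assumes p: "p > 0" and X: "X \<subseteq> carrier (lamplighter p)"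
    and gen: "generate (lamplighter p) X = carrier (lamplighter p)"
  obtains k where "\<And>f n. degree f < n \<Longrightarrow> word_within (lamplighter p) X (2 * n * k) (poly_seq p f, 0)"
proof -
  interpret group "lamplighter p" by (rule group_lamplighter)
  let ?W = "word_within (lamplighter p) X"
  define E where "E = insert (\<lambda>_. 0, 1 :: int) ((\<lambda>c. (poly_seq p [:c:], - 1)) ` {0..<int p})"
  have "E \<subseteq> carrier (lamplighter p)"
    using poly_seq_carrier[OF p] p by (auto simp: E_def lamplighter_carrier)
  then obtain k where k: "\<And>g. g \<in> E \<Longrightarrow> ?W k g"
    using word_within_finite[OF X, of E] gen by (auto simp: E_def)
  have up: "?W (n * k) (\<lambda>_. 0, int n)" for n
  proof (induction n)
    case 0
    then show ?case using word_within_one by (simp add: lamplighter_one)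
  next
    case (Suc n)
    have "(\<lambda>_. 0, 1) \<in> E" by (simp add: E_def)
    from word_within_mult[OF X k[OF this] Suc] show ?case by (simp add: lamplighter_mult)
  qed
  have down: "?W (n * k) (poly_seq p f, - int n)" if "\<And>i. i \<ge> n \<Longrightarrow> coeff f i = 0" for n f
    using that
  proof (induction n arbitrary: f)
    case 0
    then have "f = 0" by (simp add: poly_eq_iff)
    then show ?case using word_within_one by (simp add: lamplighter_one poly_seq_0)
  next
    case (Suc n)
    obtain c g where f: "f = pCons c g" by (cases f)
    have "coeff g i = 0" if "i \<ge> n" for i using Suc.prems[of "Suc i"] that f by simp
    then have g: "?W (n * k) (poly_seq p g, - int n)" by (rule Suc.IH)
    \<comment> \<open>Only residues of coefficients matter, so the finite set \<open>E\<close>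
      suffices.\<close>
    have "poly_seq p [:c:] = poly_seq p [:c mod int p:]"
      by (auto simp: poly_seq_def fun_eq_iff coeff_pCons split: nat.splits)
    then have "(poly_seq p [:c:], - 1) \<in> E" using p by (auto simp: E_def)
    from word_within_mult[OF X k[OF this] g] have "?W (k + n * k) (poly_seq p f, - int n - 1)"
      by (simp only: poly_seq_pCons f)
    moreover have "- int (Suc n) = - int n - 1" by simp
    ultimately show ?case by (simp only: mult_Suc)
  qed
  have "?W (2 * n * k) (poly_seq p f, 0)" if "degree f < n" for f n
  proof -
    have "?W (n * k) (poly_seq p f, - int n)" using that by (intro down coeff_eq_0) simp
    from word_within_mult[OF X this up[of n]] show ?thesis
      by (simp add: poly_seq_mult_zero mult_2 add_mult_distrib)
  qed
  then show thesis using that by blast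
qed

section \<open>Growth bounds\<close>

lemma RF_lamplighter_le:
  fixes X :: "((int \<Rightarrow> int) \<times> int) set"
  assumes p: "prime p" and X: "finite X" "X \<subseteq> carrier (lamplighter p)"
    and gen: "generate (lamplighter p) X = carrier (lamplighter p)"
  obtains K where "\<And>n. RF (lamplighter p) X (real n) \<le> (p * (2 * (n * K) + 2)) ^ 2"
proof -
  interpret group "lamplighter p" by (rule group_lamplighter)
  have p0: "p > 0" using prime_gt_0_nat[OF p] .
  have "finite (X \<union> m_inv (lamplighter p) ` X)" "X \<union> m_inv (lamplighter p) ` X \<subseteq> carrier (lamplighter p)"
    using X by auto
  from support_bound_exists[OF p0 this] obtain K where
    K: "\<And>a b. (a, b) \<in> X \<union> m_inv (lamplighter p) ` X \<Longrightarrow>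
      \<bar>b\<bar> \<le> int K \<and> (\<forall>i. a i \<noteq> 0 \<longrightarrow> \<bar>i\<bar> \<le> int K)"
    by blast
  have depth: "residual_depth (lamplighter p) g \<le> (p * (2 * (n * K) + 2)) ^ 2"
    if g: "g \<in> word_ball (lamplighter p) X (real n)" "g \<noteq> \<one>\<^bsub>lamplighter p\<^esub>" for g n
  proof -
    obtain a b where ab: "g = (a, b)" by (cases g)
    obtain k where k: "real k \<le> real n" "word_within (lamplighter p) X k (a, b)"
      using word_within_word_ball[OF X(2) g(1)] ab by blast
    have "int (k * K) \<le> int (n * K)" using k(1) by (simp only: of_nat_le_iff mult_le_mono1)
    then have "\<bar>b\<bar> \<le> int (n * K)" "\<And>i. a i \<noteq> 0 \<Longrightarrow> \<bar>i\<bar> \<le> int (n * K)"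
      using word_support_bound[OF p0 X(2) K k(2)] by (meson order_trans)+
    moreover have "(a, b) \<in> carrier (lamplighter p)" using g(1) gen ab by (simp add: word_ball_def)
    ultimately obtain N where "N \<lhd> lamplighter p" "finite (rcosets\<^bsub>lamplighter p\<^esub> N)" "g \<notin> N"
      "card (rcosets\<^bsub>lamplighter p\<^esub> N) \<le> (p * (2 * (n * K) + 2)) ^ 2"
      using exists_small_quotient[OF p, of a b "n * K"] g(2) ab by blast
    then show ?thesis using residual_depth_le le_trans by blast
  qed
  have "RF (lamplighter p) X (real n) \<le> (p * (2 * (n * K) + 2)) ^ 2" for n
    using finite_word_ball[OF X(2,1), of "real n"] depth by (simp add: RF_def Let_def)
  then show thesis using that by blast
qed

lemma RF_lamplighter_ge:
  fixes X :: "((int \<Rightarrow> int) \<times> int) set"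
  assumes p: "prime p" and X: "finite X" "X \<subseteq> carrier (lamplighter p)"
    and gen: "generate (lamplighter p) X = carrier (lamplighter p)"
  obtains k where "k > 0" "\<And>n R d. R * R \<le> n \<Longrightarrow> p ^ d \<le> n \<Longrightarrow> n > 0 \<Longrightarrow>
    Suc R * p ^ Suc d \<le> RF (lamplighter p) X (real (k * n))"
proof -
  interpret group "lamplighter p" by (rule group_lamplighter)
  have p0: "p > 0" using prime_gt_0_nat[OF p] .
  obtain j where j: "\<And>f n. degree f < n \<Longrightarrow> word_within (lamplighter p) X (2 * n * j) (poly_seq p f, 0)"
    using word_within_poly_seq[OF p0 X(2) gen] by blast
  \<comment> \<open>The witness has degree at most R * R + 4 * p^d \<le> 5n < 6n, which gives word
    length at most 2 * 6n * j; the successor keeps k positive.\<close>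
  define k where "k = Suc (12 * j)"
  have "Suc R * p ^ Suc d \<le> RF (lamplighter p) X (real (k * n))"
    if n: "R * R \<le> n" "p ^ d \<le> n" "n > 0" for n R d
  proof -
    define f where "f = witness_poly p R d"
    let ?g = "(poly_seq p f, 0) :: (int \<Rightarrow> int) \<times> int"
    have car: "?g \<in> carrier (lamplighter p)" by (rule poly_seq_carrier[OF p0])
    have "poly_seq p f (int (degree f)) = 1"
      using lead_coeff_witness_poly[OF p, of R d] prime_gt_1_nat[OF p] by (simp add: poly_seq_def f_def)
    then have ne: "?g \<noteq> \<one>\<^bsub>lamplighter p\<^esub>" by (metis lamplighter_one prod.inject zero_neq_one)
    have "degree f < 6 * n" using degree_witness_poly[OF p, of R d] n by (simp add: f_def)
    from j[OF this] have "word_within (lamplighter p) X (k * n) ?g"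
      by (rule word_within_mono) (simp add: k_def)
    then have ball: "?g \<in> word_ball (lamplighter p) X (real (k * n))"
      using car by (intro word_ball_word_within) (simp_all only: gen)
    have "\<bar>i\<bar> \<le> int (degree f)" if "poly_seq p f i \<noteq> 0" for i
    proof -
      have "i \<ge> 0" "coeff f (nat i) \<noteq> 0" using that by (auto simp: poly_seq_def split: if_splits)
      then show ?thesis using le_degree[of f "nat i"] by linarith
    qed
    \<comment> \<open>The size of this quotient is irrelevant; it shows that the infimum defining
      the depth is taken over a nonempty set.\<close>
    then obtain N where N: "N \<lhd> lamplighter p" "finite (rcosets\<^bsub>lamplighter p\<^esub> N)" "?g \<notin> N"
      using exists_small_quotient[OF p car ne, of "degree f"] by auto
    have "Suc R * p ^ Suc d \<le> residual_depth (lamplighter p) ?g"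
      by (rule le_residual_depth[OF N]) (rule index_avoiding_witness[OF p], simp_all add: f_def)
    also have "\<dots> \<le> RF (lamplighter p) X (real (k * n))"
      using finite_word_ball[OF X(2,1), of "real (k * n)"] ball ne
      unfolding RF_def Let_def by (auto intro!: Max_ge)
    finally show ?thesis .
  qed
  moreover have "k > 0" by (simp add: k_def)
  ultimately show thesis using that by blast
qed

theorem theorem1:
  fixes p :: nat and X :: "((int \<Rightarrow> int) \<times> int) set"
  assumes "prime p"
    and "finite X" and "X \<subseteq> carrier (lamplighter p)"
    and "generate (lamplighter p) X = carrier (lamplighter p)"
  shows "(\<lambda>n. n powr (3/2)) \<preceq> (\<lambda>n. real (RF (lamplighter p) X n)) \<and>
         (\<lambda>n. real (RF (lamplighter p) X n)) \<preceq> (\<lambda>n. n ^ 2)"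
proof
  obtain k where k0: "k > 0" and k: "\<And>n R d. R * R \<le> n \<Longrightarrow> p ^ d \<le> n \<Longrightarrow> n > 0 \<Longrightarrow>
      Suc R * p ^ Suc d \<le> RF (lamplighter p) X (real (k * n))"
    using RF_lamplighter_ge[OF assms] by blast
  show "(\<lambda>n. n powr (3/2)) \<preceq> (\<lambda>n. real (RF (lamplighter p) X n))"
    unfolding growth_le_def
  proof (intro exI[of _ "real k"] conjI allI impI)
    fix n :: nat assume n: "n > 0"
    \<comment> \<open>The lower bounds on the parameters keep the witness short, while p^(d+1) > n
      and R + 1 \<ge> sqrt n make the index bound at least n^(3/2).\<close>
    obtain d where d: "p ^ d \<le> n" "n < p ^ Suc d"
      using ex_power_ivl1[of p n] prime_ge_2_nat[OF assms(1)] n by auto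
    define R where "R = nat \<lfloor>sqrt (real n)\<rfloor>"
    have R: "real R \<le> sqrt (real n)" "sqrt (real n) \<le> real (Suc R)"
      by (simp_all add: R_def) linarith
    have "real R * real R \<le> sqrt (real n) * sqrt (real n)" using R(1) by (intro mult_mono) auto
    then have "real (R * R) \<le> real n" by simp
    then have "R * R \<le> n" by (simp only: of_nat_le_iff)
    note RF = k[OF this d(1) n]
    have "real n powr (3/2) = real n powr (1/2 + 1)" by simp
    also have "\<dots> = sqrt (real n) * real n"
      unfolding powr_add using n by (simp add: powr_half_sqrt)
    also have "\<dots> \<le> real (Suc R) * real (p ^ Suc d)"
      using R(2) d(2) by (intro mult_mono of_nat_mono) simp_all
    also have "\<dots> = real (Suc R * p ^ Suc d)" by (simp only: of_nat_mult)
    also have "\<dots> \<le> real (RF (lamplighter p) X (real (k * n)))" using RF by (simp only: of_nat_le_iff)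
    also have "\<dots> \<le> real k * real (RF (lamplighter p) X (real (k * n)))"
      using k0 by (intro mult_le_cancel_right1[THEN iffD2]) auto
    finally show "real n powr (3/2) \<le> real k * real (RF (lamplighter p) X (real k * real n))" by simp
  qed (use k0 in simp)
  obtain K where K: "\<And>n. RF (lamplighter p) X (real n) \<le> (p * (2 * (n * K) + 2)) ^ 2"
    using RF_lamplighter_le[OF assms] by blast
  \<comment> \<open>For n \<ge> 1 the constant 2 is absorbed into 2n, so p * (2nK + 2) \<le> c *
    n.\<close>
  define c where "c = 2 * p * Suc K"
  have c: "c \<ge> 1" using prime_gt_0_nat[OF assms(1)] by (simp add: c_def)
  show "(\<lambda>n. real (RF (lamplighter p) X n)) \<preceq> (\<lambda>n. n ^ 2)"
    unfolding growth_le_def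
  proof (intro exI[of _ "real c"] conjI allI impI)
    fix n :: nat assume n: "n > 0"
    have "p * (2 * (n * K) + 2) \<le> p * (2 * (n * K) + 2 * n)" using n by (intro mult_le_mono2) simp
    also have "\<dots> = c * n" by (simp add: c_def algebra_simps)
    finally have "(p * (2 * (n * K) + 2)) ^ 2 \<le> (c * n) ^ 2" by (rule power_mono) simp
    also have "\<dots> \<le> c * (c * n) ^ 2" using c by simp
    finally have "RF (lamplighter p) X (real n) \<le> c * (c * n) ^ 2" using K[of n] by (rule order_trans[rotated])
    then have "real (RF (lamplighter p) X (real n)) \<le> real (c * (c * n) ^ 2)" by (simp only: of_nat_le_iff)
    then show "real (RF (lamplighter p) X (real n)) \<le> real c * (real c * real n) ^ 2" by simp
  qed (use c in simp)
qed

end
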